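(* Let $n=5$ or $n\geqslant 7$. Suppose $\rho:WB_n\to GL_{n-1}(\mathbb{C})$ is an $(n-1)$-dimensional complex representation of the welded braid group $WB_n$ such that its restriction $\rho|_{B_n}$ to the braid group $B_n$ is equivalent to the specialization $\beta_n(z)$ of the reduced Burau representation for some $z\in\mathbb{C}^*$ with $P_n(z)\neq 0$, where $P_n(z)=1+z+\dots+z^{n-1}$. Then there exists a unique pair $(k,\beta')$ such that $\rho$ is equivalent to $X_n(1,k)\otimes\beta'$, where $k\in\{-1,1\}$ and $\beta'$ is a representation of $WB_n$ with $\beta'\in\{\widetilde{\beta_n}(z),\widehat{\beta_n}(z)\}$ if $z\neq 1$, and $\beta'=\widetilde{\beta_n}(1)$ if $z=1$.
   Context: The welded braid group $WB_n$ is the group generated by $\alpha_1,\dots,\alpha_{n-1},\sigma_1,\dots,\sigma_{n-1}$ with defining relations: $\alpha_i^2=1$ ($1\leqslant i\leqslant n-1$); $\alpha_i\alpha_j=\alpha_j\alpha_i$, $\sigma_i\sigma_j=\sigma_j\sigma_i$, $\alpha_i\sigma_j=\sigma_j\alpha_i$ for $|i-j|\geqslant 2$; and, for $1\leqslant i\leqslant n-2$, $\alpha_i\alpha_{i+1}\alpha_i=\alpha_{i+1}\alpha_i\alpha_{i+1}$, $\sigma_i\sigma_{i+1}\sigma_i=\sigma_{i+1}\sigma_i\sigma_{i+1}$, $\alpha_i\alpha_{i+1}\sigma_i=\sigma_{i+1}\alpha_i\alpha_{i+1}$, $\sigma_i\sigma_{i+1}\alpha_i=\alpha_{i+1}\sigma_i\sigma_{i+1}$.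 The subgroup generated by the $\sigma_i$ is isomorphic to the braid group on $n$ strings and is denoted $B_n$. Matrices act on column vectors. For $y\in\mathbb{C}^*$, $k\in\{-1,1\}$, $X_n(y,k):WB_n\to\mathbb{C}^*$ is the one-dimensional representation $\sigma_i\mapsto y$, $\alpha_i\mapsto k$ for all $i$. Below $I_m$ is the $m\times m$ identity, $\oplus$ denotes block-diagonal sum, and $2\leqslant i\leqslant n-2$. For $z\in\mathbb{C}^*$, the reduced Burau representation $\beta_n(z):B_n\to GL_{n-1}(\mathbb{C})$ is $$\beta_n(z)(\sigma_1)=\begin{pmatrix}-z&0\\1&1\end{pmatrix}\oplus I_{n-3},\quad \beta_n(z)(\sigma_i)=I_{i-2}\oplus\begin{pmatrix}1&z&0\\0&-z&0\\0&1&1\end{pmatrix}\oplus I_{n-i-2},\quad \beta_n(z)(\sigma_{n-1})=I_{n-3}\oplus\begin{pmatrix}1&z\\0&-z\end{pmatrix}.$$ The representations $\widetilde{\beta_n}(z),\widehat{\beta_n}(z):WB_n\to GL_{n-1}(\mathbb{C})$ are given by $$\widetilde{\beta_n}(z)(\sigma_1)=\begin{pmatrix}-z&1\\0&1\end{pmatrix}\oplus I_{n-3},\quad \widetilde{\beta_n}(z)(\sigma_i)=I_{i-2}\oplus\begin{pmatrix}1&0&0\\ z&-z&1\\0&0&1\end{pmatrix}\oplus I_{n-i-2},\quad \widetilde{\beta_n}(z)(\sigma_{n-1})=I_{n-3}\oplus\begin{pmatrix}1&0\\ z&-z\end{pmatrix},$$ $$\widetilde{\beta_n}(z)(\alpha_1)=\begin{pmatrix}-1&1\\0&1\end{pmatrix}\oplus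 I_{n-3},\quad \widetilde{\beta_n}(z)(\alpha_i)=I_{i-2}\oplus\begin{pmatrix}1&0&0\\1&-1&1\\0&0&1\end{pmatrix}\oplus I_{n-i-2},\quad \widetilde{\beta_n}(z)(\alpha_{n-1})=I_{n-3}\oplus\begin{pmatrix}1&0\\1&-1\end{pmatrix},$$ and $\widehat{\beta_n}(z)(\sigma_j)=\beta_n(z)(\sigma_j)$ for all $j$ (the matrices above), with $$\widehat{\beta_n}(z)(\alpha_1)=\begin{pmatrix}-1&0\\ \frac1z&1\end{pmatrix}\oplus I_{n-3},\quad \widehat{\beta_n}(z)(\alpha_i)=I_{i-2}\oplus\begin{pmatrix}1&z&0\\0&-1&0\\0&\frac1z&1\end{pmatrix}\oplus I_{n-i-2},\quad \widehat{\beta_n}(z)(\alpha_{n-1})=I_{n-3}\oplus\begin{pmatrix}1&z\\0&-1\end{pmatrix}.$$ *)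

theory Defs
  imports "HOL-Algebra.Algebra" "Jordan_Normal_Form.Matrix" Complex_Main
begin

section \<open>Groups given by generators and relations\<close>

text \<open>The letter \<open>(x, True)\<close> stands for the generator \<open>x\<close> and \<open>(x, False)\<close> for its inverse.\<close>

type_synonym 'a word = "('a \<times> bool) list"

abbreviation words :: "'a set \<Rightarrow> 'a word set" where
  "words S \<equiv> lists (S \<times> UNIV)"

definition pos :: "'a list \<Rightarrow> 'a word" where
  "pos xs = map (\<lambda>x. (x, True)) xs"

inductive pres_cong :: "'a set \<Rightarrow> ('a word \<times> 'a word) set \<Rightarrow> 'a word \<Rightarrow> 'a word \<Rightarrow> bool"
  for S :: "'a set" and R :: "('a word \<times> 'a word) set" where
  refl: "w \<in> words S \<Longrightarrow> pres_cong S R w w"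
| sym: "pres_cong S R u v \<Longrightarrow> pres_cong S R v u"
| trans: "pres_cong S R u v \<Longrightarrow> pres_cong S R v w \<Longrightarrow> pres_cong S R u w"
| append: "pres_cong S R u u' \<Longrightarrow> pres_cong S R v v' \<Longrightarrow> pres_cong S R (u @ v) (u' @ v')"
| cancel: "x \<in> S \<Longrightarrow> pres_cong S R [(x, b), (x, \<not> b)] []"
| relation: "(u, v) \<in> R \<Longrightarrow> u \<in> words S \<Longrightarrow> v \<in> words S \<Longrightarrow> pres_cong S R u v"

definition pres_class :: "'a set \<Rightarrow> ('a word \<times> 'a word) set \<Rightarrow> 'a word \<Rightarrow> 'a word set" where
  "pres_class S R u = {v. pres_cong S R u v}"

definition presented_group :: "'a set \<Rightarrow> ('a word \<times> 'a word) set \<Rightarrow> 'a word set monoid" where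
  "presented_group S R =
     \<lparr>carrier = pres_class S R ` words S,
      monoid.mult = (\<lambda>A B. {w. \<exists>u\<in>A. \<exists>v\<in>B. pres_cong S R (u @ v) w}),
      one = pres_class S R []\<rparr>"

lemma pres_cong_words:
  "pres_cong S R u v \<Longrightarrow> u \<in> words S \<and> v \<in> words S"
  by (induction rule: pres_cong.induct) auto

lemma pres_class_eq_iff:
  assumes "u \<in> words S"
  shows "pres_class S R u = pres_class S R v \<longleftrightarrow> pres_cong S R u v"
  using assms unfolding pres_class_def
  by (auto intro: pres_cong.refl pres_cong.sym pres_cong.trans dest: pres_cong_words)

lemma mult_pres_class:
  assumes "u \<in> words S" "v \<in> words S"
  shows "pres_class S R u \<otimes>\<^bsub>presented_group S R\<^esub> pres_class S R v = pres_class S R (u @ v)"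
proof -
  have "pres_cong S R (u @ v) w"
    if "pres_cong S R u u'" "pres_cong S R v v'" "pres_cong S R (u' @ v') w" for u' v' w
    using that by (meson pres_cong.append pres_cong.trans)
  then show ?thesis
    using assms by (auto simp: presented_group_def pres_class_def intro: pres_cong.refl)
qed

lemma pres_cong_inverse:
  assumes "u \<in> words S"
  shows "pres_cong S R (rev (map (\<lambda>(x, b). (x, \<not> b)) u) @ u) []"
  using assms
proof (induction u rule: list.induct)
  case Nil
  then show ?case by (simp add: pres_cong.refl)
next
  case (Cons a u)
  obtain x b where a: "a = (x, b)" by (cases a)
  let ?u' = "rev (map (\<lambda>(x, b). (x, \<not> b)) u)"
  have x: "x \<in> S" and u: "u \<in> words S"
    using Cons.prems a by auto
  have u': "?u' \<in> words S" using u by (auto simp: lists_eq_set)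
  have "pres_cong S R [(x, \<not> b), (x, b)] []"
    using pres_cong.cancel[OF x, of R "\<not> b"] by simp
  then have "pres_cong S R (?u' @ ([(x, \<not> b), (x, b)] @ u)) (?u' @ ([] @ u))"
    using u u' by (intro pres_cong.append pres_cong.refl)
  moreover have "pres_cong S R (?u' @ u) []"
    using Cons.IH u by blast
  ultimately show ?case
    using a by (auto intro: pres_cong.trans)
qed

lemma group_presented_group: "group (presented_group S R)"
proof (rule groupI)
  let ?G = "presented_group S R"
  have car: "carrier ?G = pres_class S R ` words S" and one: "\<one>\<^bsub>?G\<^esub> = pres_class S R []"
    by (simp_all add: presented_group_def)
  show "\<one>\<^bsub>?G\<^esub> \<in> carrier ?G"
    by (auto simp: car one)
  fix A assume "A \<in> carrier ?G"
  then obtain u where u: "u \<in> words S" and A: "A = pres_class S R u"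
    by (auto simp: car)
  show "\<one>\<^bsub>?G\<^esub> \<otimes>\<^bsub>?G\<^esub> A = A"
    using u by (simp add: one A mult_pres_class)
  let ?u' = "rev (map (\<lambda>(x, b). (x, \<not> b)) u)"
  have u': "?u' \<in> words S"
    using u by (auto simp: lists_eq_set)
  have "pres_class S R ?u' \<otimes>\<^bsub>?G\<^esub> A = \<one>\<^bsub>?G\<^esub>"
    using u u' pres_cong_inverse[OF u, of R] pres_class_eq_iff[of "?u' @ u" S R "[]"]
    by (simp add: one A mult_pres_class del: rev_map)
  then show "\<exists>B\<in>carrier ?G. B \<otimes>\<^bsub>?G\<^esub> A = \<one>\<^bsub>?G\<^esub>"
    using u' car by blast
  fix B assume "B \<in> carrier ?G"
  then obtain v where v: "v \<in> words S" and B: "B = pres_class S R v"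
    by (auto simp: car)
  show "A \<otimes>\<^bsub>?G\<^esub> B \<in> carrier ?G"
    using u v by (simp add: A B mult_pres_class car)
  fix C assume "C \<in> carrier ?G"
  then obtain w where w: "w \<in> words S" and C: "C = pres_class S R w"
    by (auto simp: car)
  show "A \<otimes>\<^bsub>?G\<^esub> B \<otimes>\<^bsub>?G\<^esub> C = A \<otimes>\<^bsub>?G\<^esub> (B \<otimes>\<^bsub>?G\<^esub> C)"
    using u v w by (simp add: A B C mult_pres_class)
qed

section \<open>The welded braid group\<close>

datatype wb_gen = Alpha nat | Sigma nat

definition wb_gens :: "nat \<Rightarrow> wb_gen set" where
  "wb_gens n = Alpha ` {1..n - 1} \<union> Sigma ` {1..n - 1}"

definition wb_relations :: "nat \<Rightarrow> (wb_gen list \<times> wb_gen list) set" where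
  "wb_relations n =
     (\<Union>i\<in>{1..n - 1}. {([Alpha i, Alpha i], [])}) \<union>
     (\<Union>i\<in>{1..n - 1}. \<Union>j\<in>{j \<in> {1..n - 1}. \<bar>int i - int j\<bar> \<ge> 2}.
        {([Alpha i, Alpha j], [Alpha j, Alpha i]),
         ([Sigma i, Sigma j], [Sigma j, Sigma i]),
         ([Alpha i, Sigma j], [Sigma j, Alpha i])}) \<union>
     (\<Union>i\<in>{1..n - 2}.
        {([Alpha i, Alpha (i + 1), Alpha i], [Alpha (i + 1), Alpha i, Alpha (i + 1)]),
         ([Sigma i, Sigma (i + 1), Sigma i], [Sigma (i + 1), Sigma i, Sigma (i + 1)]),
         ([Alpha i, Alpha (i + 1), Sigma i], [Sigma (i + 1), Alpha i, Alpha (i + 1)]),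
         ([Sigma i, Sigma (i + 1), Alpha i], [Alpha (i + 1), Sigma i, Sigma (i + 1)])})"

definition welded_braid_group :: "nat \<Rightarrow> wb_gen word set monoid" where
  "welded_braid_group n = presented_group (wb_gens n) (map_prod pos pos ` wb_relations n)"

definition wb_elem :: "nat \<Rightarrow> wb_gen \<Rightarrow> wb_gen word set" where
  "wb_elem n x = pres_class (wb_gens n) (map_prod pos pos ` wb_relations n) (pos [x])"

definition braid_subgroup :: "nat \<Rightarrow> wb_gen word set monoid" where
  "braid_subgroup n =
     subgroup_generated (welded_braid_group n) ((\<lambda>i. wb_elem n (Sigma i)) ` {1..n - 1})"

section \<open>Representations\<close>

definition GL :: "nat \<Rightarrow> complex mat monoid" where
  "GL m = units_of (ring_mat TYPE(complex) m ())"

definition nonzero_complex :: "complex monoid" where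
  "nonzero_complex = \<lparr>carrier = UNIV - {0}, monoid.mult = (*), one = 1\<rparr>"

definition rep_equiv ::
  "('g, 'b) monoid_scheme \<Rightarrow> nat \<Rightarrow> ('g \<Rightarrow> complex mat) \<Rightarrow> ('g \<Rightarrow> complex mat) \<Rightarrow> bool" where
  "rep_equiv G m \<rho> \<rho>' \<longleftrightarrow>
     (\<exists>P\<in>carrier (GL m). \<forall>g\<in>carrier G. \<rho>' g = P \<otimes>\<^bsub>GL m\<^esub> \<rho> g \<otimes>\<^bsub>GL m\<^esub> inv\<^bsub>GL m\<^esub> P)"

text \<open>The tensor product of a one-dimensional representation \<open>\<chi>\<close> with a matrix representation;
  the space \<open>\<complex> \<otimes> \<complex>\<^sup>m\<close> is identified with \<open>\<complex>\<^sup>m\<close>. The result is made extensional, as are the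
  homomorphisms below, so that equality of functions is equality of maps on \<open>carrier G\<close>.\<close>

definition char_tensor ::
  "('g, 'b) monoid_scheme \<Rightarrow> ('g \<Rightarrow> complex) \<Rightarrow> ('g \<Rightarrow> complex mat) \<Rightarrow> 'g \<Rightarrow> complex mat" where
  "char_tensor G \<chi> \<rho> = (\<lambda>g\<in>carrier G. \<chi> g \<cdot>\<^sub>m \<rho> g)"

text \<open>The homomorphism \<open>G \<rightarrow> K\<close> that sends the generator \<open>x i\<close> of \<open>G\<close> to \<open>f i\<close> for every \<open>i \<in> I\<close>.
  It is unique when the \<open>x i\<close> generate \<open>G\<close>; it exists when the \<open>f i\<close> satisfy the relations of \<open>G\<close>.\<close>

definition hom_on_gens ::
  "('g, 'b) monoid_scheme \<Rightarrow> ('k, 'c) monoid_scheme \<Rightarrow> 'i set \<Rightarrow> ('i \<Rightarrow> 'g) \<Rightarrow> ('i \<Rightarrow> 'k) \<Rightarrow> 'g \<Rightarrow> 'k"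
  where
  "hom_on_gens G K I x f =
     (THE h. h \<in> hom G K \<and> h \<in> extensional (carrier G) \<and> (\<forall>i\<in>I. h (x i) = f i))"

definition X_rep :: "nat \<Rightarrow> complex \<Rightarrow> complex \<Rightarrow> wb_gen word set \<Rightarrow> complex" where
  "X_rep n y k =
     hom_on_gens (welded_braid_group n) nonzero_complex (wb_gens n) (wb_elem n)
       (\<lambda>x. case x of Sigma i \<Rightarrow> y | Alpha i \<Rightarrow> k)"

text \<open>The three block shapes, for the first, an inner and the last index, shared by all families of
  matrices below.\<close>

definition local_mat ::
  "nat \<Rightarrow> complex list list \<Rightarrow> complex list list \<Rightarrow> complex list list \<Rightarrow> nat \<Rightarrow> complex mat" where
  "local_mat n A B C i =
     (if i = 1 then diag_block_mat [mat_of_rows_list 2 A, 1\<^sub>m (n - 3)]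
      else if i = n - 1 then diag_block_mat [1\<^sub>m (n - 3), mat_of_rows_list 2 C]
      else diag_block_mat [1\<^sub>m (i - 2), mat_of_rows_list 3 B, 1\<^sub>m (n - i - 2)])"

definition burau_sigma :: "nat \<Rightarrow> complex \<Rightarrow> nat \<Rightarrow> complex mat" where
  "burau_sigma n z = local_mat n
     [[-z, 0],
      [ 1, 1]]
     [[1,  z, 0],
      [0, -z, 0],
      [0,  1, 1]]
     [[1,  z],
      [0, -z]]"

definition burau_tilde_sigma :: "nat \<Rightarrow> complex \<Rightarrow> nat \<Rightarrow> complex mat" where
  "burau_tilde_sigma n z = local_mat n
     [[-z, 1],
      [ 0, 1]]
     [[1,  0, 0],
      [z, -z, 1],
      [0,  0, 1]]
     [[1,  0],
      [z, -z]]"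

definition burau_tilde_alpha :: "nat \<Rightarrow> nat \<Rightarrow> complex mat" where
  "burau_tilde_alpha n = local_mat n
     [[-1, 1],
      [ 0, 1]]
     [[1,  0, 0],
      [1, -1, 1],
      [0,  0, 1]]
     [[1,  0],
      [1, -1]]"

definition burau_hat_alpha :: "nat \<Rightarrow> complex \<Rightarrow> nat \<Rightarrow> complex mat" where
  "burau_hat_alpha n z = local_mat n
     [[   -1, 0],
      [1 / z, 1]]
     [[1,     z, 0],
      [0,    -1, 0],
      [0, 1 / z, 1]]
     [[1,  z],
      [0, -1]]"

definition burau :: "nat \<Rightarrow> complex \<Rightarrow> wb_gen word set \<Rightarrow> complex mat" where
  "burau n z =
     hom_on_gens (braid_subgroup n) (GL (n - 1)) {1..n - 1} (\<lambda>i. wb_elem n (Sigma i))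
       (burau_sigma n z)"

definition burau_tilde :: "nat \<Rightarrow> complex \<Rightarrow> wb_gen word set \<Rightarrow> complex mat" where
  "burau_tilde n z =
     hom_on_gens (welded_braid_group n) (GL (n - 1)) (wb_gens n) (wb_elem n)
       (\<lambda>x. case x of Sigma i \<Rightarrow> burau_tilde_sigma n z i | Alpha i \<Rightarrow> burau_tilde_alpha n i)"

definition burau_hat :: "nat \<Rightarrow> complex \<Rightarrow> wb_gen word set \<Rightarrow> complex mat" where
  "burau_hat n z =
     hom_on_gens (welded_braid_group n) (GL (n - 1)) (wb_gens n) (wb_elem n)
       (\<lambda>x. case x of Sigma i \<Rightarrow> burau_sigma n z i | Alpha i \<Rightarrow> burau_hat_alpha n z i)"

end

theory Submission
  imports Defs "Jordan_Normal_Form.Determinant"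
begin

text \<open>
  Extend \<open>(x\<^sub>1, \<dots>, x\<^sub>n\<^sub>-\<^sub>1)\<close> by \<open>x\<^sub>0 = x\<^sub>n = 0\<close>. The transpose of the Burau matrix of \<open>\<sigma>\<^sub>i\<close> replaces \<open>x\<^sub>i\<close> by
  \<open>z x\<^sub>i\<^sub>-\<^sub>1 - z x\<^sub>i + x\<^sub>i\<^sub>+\<^sub>1\<close>, that is, it adds \<open>f\<^sub>i(x) e\<^sub>i\<close> with \<open>f\<^sub>i(x) = z x\<^sub>i\<^sub>-\<^sub>1 - (1 + z) x\<^sub>i + x\<^sub>i\<^sub>+\<^sub>1\<close>. The
  tilde matrix of \<open>\<sigma>\<^sub>i\<close> is given by the same update, untransposed. The matrices of \<open>\<alpha>\<^sub>i\<close> in both families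
  come from the update \<open>x\<^sub>i \<mapsto> s x\<^sub>i\<^sub>-\<^sub>1 - x\<^sub>i + s\<^sup>-\<^sup>1 x\<^sub>i\<^sub>+\<^sub>1\<close>, with \<open>s = 1\<close> for the tilde family and \<open>s = z\<close>
  for the transposes of the hat family. So the defining relations become identities between updates of
  neighbouring coordinates, read in opposite orders for the two families, and both families are
  representations (\<open>burau_tilde_rep\<close>, \<open>burau_hat_rep\<close>).

  Now let a representation have the Burau matrices as images of the \<open>\<sigma>\<^sub>i\<close>. It is determined by the image
  of \<open>\<alpha>\<^sub>1\<close> (\<open>hom_determined_by_sigmas_and_alpha_one\<close>). Let \<open>A\<^sub>i\<close> be the transposed image of \<open>\<alpha>\<^sub>i\<close>.
  Commutation with \<open>\<sigma>\<^sub>3, \<dots>, \<sigma>\<^sub>n\<^sub>-\<^sub>1\<close> makes \<open>A\<^sub>1 - c\<close>, for some \<open>c = \<plusminus>1\<close>, a map that depends on \<open>x\<^sub>1, x\<^sub>2\<close>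
  only and takes values in the common kernel of \<open>f\<^sub>3, \<dots>, f\<^sub>n\<^sub>-\<^sub>1\<close>. Commutation of \<open>\<alpha>\<^sub>1\<close> with \<open>\<alpha>\<^sub>3\<close>, a
  conjugate of \<open>\<alpha>\<^sub>1\<close> by a braid, forces this map to have rank at most one, with either its image or its
  kernel prescribed. The relations \<open>\<alpha>\<^sub>1\<^sup>2 = 1\<close> and \<open>\<alpha>\<^sub>1 \<alpha>\<^sub>2 \<sigma>\<^sub>1 = \<sigma>\<^sub>2 \<alpha>\<^sub>1 \<alpha>\<^sub>2\<close> leave one solution in either case
  (\<open>alpha_one_dichotomy\<close>). The first solution is \<open>c\<close> times the hat matrix. The second becomes \<open>c\<close> times the
  tilde matrix after conjugation by the symmetric matrix \<open>z\<^sup>-\<^sup>i f\<^sub>i(e\<^sub>j)\<close>, which is invertible because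
  \<open>P\<^sub>n(z) \<noteq> 0\<close>. For \<open>z = 1\<close> the first solution is an instance of the second.

  Uniqueness is read off two traces (\<open>twist_invariants\<close>): at \<open>\<alpha>\<^sub>1\<close> the trace is \<open>k (n - 3)\<close>, and at
  \<open>\<sigma>\<^sub>1 \<alpha>\<^sub>2\<close> it is \<open>k (s - z + n - 4)\<close>.
\<close>

section \<open>Homomorphisms out of a presented group\<close>

definition eval_word :: "('k, 'c) monoid_scheme \<Rightarrow> ('a \<Rightarrow> 'k) \<Rightarrow> 'a word \<Rightarrow> 'k" where
  "eval_word K f w =
     foldr (\<lambda>(x, b) a. (if b then f x else inv\<^bsub>K\<^esub> f x) \<otimes>\<^bsub>K\<^esub> a) w \<one>\<^bsub>K\<^esub>"

definition eval_list :: "('k, 'c) monoid_scheme \<Rightarrow> ('a \<Rightarrow> 'k) \<Rightarrow> 'a list \<Rightarrow> 'k" where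
  "eval_list K f xs = foldr (\<lambda>x a. f x \<otimes>\<^bsub>K\<^esub> a) xs \<one>\<^bsub>K\<^esub>"

lemma eval_word_simps [simp]:
  "eval_word K f [] = \<one>\<^bsub>K\<^esub>"
  "eval_word K f ((x, b) # w) = (if b then f x else inv\<^bsub>K\<^esub> f x) \<otimes>\<^bsub>K\<^esub> eval_word K f w"
  by (simp_all add: eval_word_def)

lemma eval_list_simps [simp]:
  "eval_list K f [] = \<one>\<^bsub>K\<^esub>" "eval_list K f (x # xs) = f x \<otimes>\<^bsub>K\<^esub> eval_list K f xs"
  by (simp_all add: eval_list_def)

lemma eval_word_pos: "eval_word K f (pos xs) = eval_list K f xs"
  by (induction xs) (simp_all add: pos_def)

lemma (in group) eval_word_closed:
  assumes "f \<in> S \<rightarrow> carrier G" "w \<in> words S"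
  shows "eval_word G f w \<in> carrier G"
  using assms(2)
proof (induction w rule: list.induct)
  case (Cons a w)
  then show ?case using assms(1) by (cases a) (auto dest: funcset_mem)
qed simp

lemma (in group) eval_word_append:
  assumes "f \<in> S \<rightarrow> carrier G" "v \<in> words S" "w \<in> words S"
  shows "eval_word G f (v @ w) = eval_word G f v \<otimes> eval_word G f w"
  using assms(2)
proof (induction v rule: list.induct)
  case Nil
  then show ?case using eval_word_closed[OF assms(1,3)] by simp
next
  case (Cons a v)
  obtain x b where a: "a = (x, b)" by (cases a)
  with Cons.prems have x: "x \<in> S" and v: "v \<in> words S" by auto
  have "f x \<in> carrier G" using assms(1) x by (rule funcset_mem)
  then show ?case
    using Cons.IH v eval_word_closed[OF assms(1) v] eval_word_closed[OF assms(1,3)]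
    by (simp add: a m_assoc)
qed

lemma (in group) eval_word_pres_cong:
  assumes f: "f \<in> S \<rightarrow> carrier G"
    and R: "\<And>u v. (u, v) \<in> R \<Longrightarrow> eval_word G f u = eval_word G f v"
    and "pres_cong S R u v"
  shows "eval_word G f u = eval_word G f v"
  using assms(3)
proof (induction rule: pres_cong.induct)
  case (append u u' v v')
  then show ?case
    using eval_word_append[OF f] pres_cong_words by metis
next
  case (cancel x b)
  then show ?case using f by (auto dest: funcset_mem)
qed (auto simp: R)

text \<open>Evaluation of words is constant on congruence classes, so a homomorphism can be read off any
  representative of a class.\<close>

lemma (in group) presented_group_hom_exists:
  assumes f: "f \<in> S \<rightarrow> carrier G"
    and R: "\<And>u v. (u, v) \<in> R \<Longrightarrow> eval_word G f u = eval_word G f v"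
  obtains h where "h \<in> hom (presented_group S R) G"
    and "\<And>w. w \<in> words S \<Longrightarrow> h (pres_class S R w) = eval_word G f w"
proof -
  define h where "h A = eval_word G f (SOME u. u \<in> A)" for A
  have val: "h (pres_class S R w) = eval_word G f w" if "w \<in> words S" for w
  proof -
    have "w \<in> pres_class S R w" using that by (simp add: pres_class_def pres_cong.refl)
    then have "(SOME u. u \<in> pres_class S R w) \<in> pres_class S R w" by (rule someI)
    then have "pres_cong S R w (SOME u. u \<in> pres_class S R w)" by (simp add: pres_class_def)
    then show ?thesis using eval_word_pres_cong[OF f R] by (simp add: h_def)
  qed
  have car: "carrier (presented_group S R) = pres_class S R ` words S"
    by (simp add: presented_group_def)
  have "h \<in> hom (presented_group S R) G"
  proof (rule homI)
    fix A assume "A \<in> carrier (presented_group S R)"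
    then obtain u where u: "u \<in> words S" "A = pres_class S R u" by (auto simp: car)
    then show "h A \<in> carrier G" by (simp add: val eval_word_closed[OF f])
    fix B assume "B \<in> carrier (presented_group S R)"
    then obtain v where v: "v \<in> words S" "B = pres_class S R v" by (auto simp: car)
    have "u @ v \<in> words S" using u(1) v(1) by simp
    then show "h (A \<otimes>\<^bsub>presented_group S R\<^esub> B) = h A \<otimes> h B"
      using u v by (simp only: u v mult_pres_class val eval_word_append[OF f])
  qed
  then show thesis using that val by blast
qed

lemma generator_in_presented_group:
  "x \<in> S \<Longrightarrow> pres_class S R (pos [x]) \<in> carrier (presented_group S R)"
  by (auto simp: presented_group_def pos_def)

lemma presented_group_generate:
  "generate (presented_group S R) ((\<lambda>x. pres_class S R (pos [x])) ` S) = carrier (presented_group S R)"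
proof
  interpret group "presented_group S R" by (rule group_presented_group)
  let ?X = "(\<lambda>x. pres_class S R (pos [x])) ` S"
  show "generate (presented_group S R) ?X \<subseteq> carrier (presented_group S R)"
    by (intro generate_incl) (auto simp: generator_in_presented_group)
  have one: "\<one>\<^bsub>presented_group S R\<^esub> = pres_class S R []" by (simp add: presented_group_def)
  have "pres_class S R w \<in> generate (presented_group S R) ?X" if "w \<in> words S" for w
    using that
  proof (induction w rule: list.induct)
    case Nil
    then show ?case using generate.one one by metis
  next
    case (Cons a w)
    obtain x b where a: "a = (x, b)" by (cases a)
    with Cons.prems have x: "x \<in> S" and w: "w \<in> words S" by auto
    have pos: "pres_class S R [(x, True)] \<in> ?X" using x by (auto simp: pos_def)
    have "pres_class S R [(x, False)] \<otimes>\<^bsub>presented_group S R\<^esub> pres_class S R [(x, True)] = \<one>\<^bsub>presented_group S R\<^esub>"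
      using x pres_cong.cancel[OF x, of R False] by (simp add: mult_pres_class one pres_class_eq_iff)
    then have "inv\<^bsub>presented_group S R\<^esub> pres_class S R [(x, True)] = pres_class S R [(x, False)]"
      by (intro inv_equality) (use x in \<open>auto simp: presented_group_def\<close>)
    then have "pres_class S R [(x, b)] \<in> generate (presented_group S R) ?X"
      using generate.incl[OF pos, of "presented_group S R"] generate.inv[OF pos, of "presented_group S R"]
      by (cases b) auto
    then have "pres_class S R [(x, b)] \<otimes>\<^bsub>presented_group S R\<^esub> pres_class S R w \<in> generate (presented_group S R) ?X"
      using Cons.IH w by (intro generate.eng)
    then show ?case using x w by (simp add: a mult_pres_class)
  qed
  then show "carrier (presented_group S R) \<subseteq> generate (presented_group S R) ?X"
    by (auto simp: presented_group_def)
qed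

lemma hom_eq_on_generate:
  assumes G: "group G" and K: "group K" and h: "h \<in> hom G K" "h' \<in> hom G K"
    and Gs: "Gs \<subseteq> carrier G" and eq: "\<And>x. x \<in> Gs \<Longrightarrow> h x = h' x" and g: "g \<in> generate G Gs"
  shows "h g = h' g"
proof -
  interpret h: group_hom G K h using G K h by (simp add: group_hom_def group_hom_axioms_def)
  interpret h': group_hom G K h' using G K h by (simp add: group_hom_def group_hom_axioms_def)
  show ?thesis using g
  proof (induction rule: generate.induct)
    case (inv x)
    then show ?case using Gs eq by (auto simp: h.hom_inv h'.hom_inv)
  next
    case (eng x y)
    then have "x \<in> carrier G" "y \<in> carrier G" using h.G.generate_in_carrier[OF Gs] by auto
    then show ?case using eng by simp
  qed (auto simp: eq)
qed

text \<open>The definite description in \<open>hom_on_gens\<close> denotes something as soon as one homomorphism with the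
  prescribed values is known: the generators leave no freedom, and restriction to the carrier makes
  the function itself unique.\<close>

lemma hom_on_gens_characterization:
  assumes G: "group G" and K: "group K" and h: "h \<in> hom G K"
    and val: "\<And>i. i \<in> I \<Longrightarrow> h (x i) = f i"
    and Gs: "x ` I \<subseteq> carrier G" and gen: "generate G (x ` I) = carrier G"
  shows "hom_on_gens G K I x f \<in> hom G K"
    and "\<And>i. i \<in> I \<Longrightarrow> hom_on_gens G K I x f (x i) = f i"
proof -
  interpret group G by (rule G)
  let ?h = "restrict h (carrier G)"
  have hom: "?h \<in> hom G K" using h by (auto simp: hom_def)
  have "hom_on_gens G K I x f = ?h"
    unfolding hom_on_gens_def
  proof (rule the_equality)
    show "?h \<in> hom G K \<and> ?h \<in> extensional (carrier G) \<and> (\<forall>i\<in>I. ?h (x i) = f i)"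
      using hom Gs val by auto
  next
    fix h' assume h': "h' \<in> hom G K \<and> h' \<in> extensional (carrier G) \<and> (\<forall>i\<in>I. h' (x i) = f i)"
    show "h' = ?h"
    proof (rule extensionalityI)
      show "h' \<in> extensional (carrier G)" "?h \<in> extensional (carrier G)" using h' by auto
      fix g assume "g \<in> carrier G"
      moreover have "h' y = ?h y" if "y \<in> x ` I" for y using that h' Gs val by auto
      ultimately show "h' g = ?h g"
        using hom_eq_on_generate[OF G K _ hom Gs, of h' g] h' gen by blast
    qed
  qed
  then show "hom_on_gens G K I x f \<in> hom G K"
    and "\<And>i. i \<in> I \<Longrightarrow> hom_on_gens G K I x f (x i) = f i"
    using hom Gs val by auto
qed

section \<open>The welded braid group\<close>

lemma group_welded_braid: "group (welded_braid_group n)"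
  unfolding welded_braid_group_def by (rule group_presented_group)

lemma wb_elem_in: "x \<in> wb_gens n \<Longrightarrow> wb_elem n x \<in> carrier (welded_braid_group n)"
  unfolding welded_braid_group_def wb_elem_def by (rule generator_in_presented_group)

lemma wb_elem_generate: "generate (welded_braid_group n) (wb_elem n ` wb_gens n) = carrier (welded_braid_group n)"
  unfolding welded_braid_group_def wb_elem_def[abs_def] by (rule presented_group_generate)

lemma welded_braid_hom_on_gens:
  assumes K: "group K" and f: "f \<in> wb_gens n \<rightarrow> carrier K"
    and R: "\<And>u v. (u, v) \<in> wb_relations n \<Longrightarrow> eval_list K f u = eval_list K f v"
  defines "h \<equiv> hom_on_gens (welded_braid_group n) K (wb_gens n) (wb_elem n) f"
  shows "h \<in> hom (welded_braid_group n) K" and "\<And>x. x \<in> wb_gens n \<Longrightarrow> h (wb_elem n x) = f x"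
proof -
  interpret K: group K by (rule K)
  let ?R = "map_prod pos pos ` wb_relations n"
  have "eval_word K f u = eval_word K f v" if "(u, v) \<in> ?R" for u v
    using that R by (auto simp: eval_word_pos)
  from K.presented_group_hom_exists[OF f this, of ?R]
  obtain h' where h': "h' \<in> hom (welded_braid_group n) K"
    and val: "\<And>w. w \<in> words (wb_gens n) \<Longrightarrow> h' (pres_class (wb_gens n) ?R w) = eval_word K f w"
    unfolding welded_braid_group_def by metis
  have "h' (wb_elem n x) = f x" if "x \<in> wb_gens n" for x
  proof -
    have "h' (wb_elem n x) = eval_word K f (pos [x])"
      unfolding wb_elem_def by (rule val) (use that in \<open>simp add: pos_def\<close>)
    then show ?thesis using f that by (auto simp: eval_word_pos dest: funcset_mem)
  qed
  note * = hom_on_gens_characterization[OF group_welded_braid K h' this _ wb_elem_generate]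
  show "h \<in> hom (welded_braid_group n) K" "\<And>x. x \<in> wb_gens n \<Longrightarrow> h (wb_elem n x) = f x"
    unfolding h_def using *(1,2) wb_elem_in by blast+
qed

lemma eval_list_pos_class:
  "xs \<in> lists S \<Longrightarrow>
   eval_list (presented_group S R) (\<lambda>x. pres_class S R (pos [x])) xs = pres_class S R (pos xs)"
proof (induction xs)
  case Nil
  then show ?case by (simp add: presented_group_def pos_def)
next
  case (Cons x xs)
  then have "pos [x] \<in> words S" "pos xs \<in> words S" "xs \<in> lists S" by (auto simp: pos_def lists_eq_set)
  then show ?case using Cons.IH mult_pres_class[of "pos [x]" S "pos xs" R] by (simp add: pos_def)
qed

lemma wb_relation_holds:
  assumes "(u, v) \<in> wb_relations n" "u \<in> lists (wb_gens n)" "v \<in> lists (wb_gens n)"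
  shows "eval_list (welded_braid_group n) (wb_elem n) u = eval_list (welded_braid_group n) (wb_elem n) v"
proof -
  let ?R = "map_prod pos pos ` wb_relations n"
  have "pos w \<in> words (wb_gens n)" if "w \<in> lists (wb_gens n)" for w
    using that by (auto simp: pos_def lists_eq_set)
  then have "pres_cong (wb_gens n) ?R (pos u) (pos v)" "pos u \<in> words (wb_gens n)"
    using assms by (auto intro!: pres_cong.relation)
  then show ?thesis
    using assms(2,3)
    unfolding welded_braid_group_def wb_elem_def[abs_def]
    by (simp add: eval_list_pos_class pres_class_eq_iff)
qed

lemma hom_eval_list:
  assumes "group G" "group K" "h \<in> hom G K" "\<And>x. x \<in> set xs \<Longrightarrow> g x \<in> carrier G"
  shows "h (eval_list G g xs) = eval_list K (h \<circ> g) xs \<and> eval_list G g xs \<in> carrier G"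
proof -
  interpret group_hom G K h using assms by (simp add: group_hom_def group_hom_axioms_def)
  show ?thesis using assms(4) by (induction xs) auto
qed

lemma hom_wb_relation:
  assumes K: "group K" and h: "h \<in> hom (welded_braid_group n) K"
    and uv: "(u, v) \<in> wb_relations n" "set u \<subseteq> wb_gens n" "set v \<subseteq> wb_gens n"
  shows "eval_list K (\<lambda>x. h (wb_elem n x)) u = eval_list K (\<lambda>x. h (wb_elem n x)) v"
proof -
  have "eval_list K (h \<circ> wb_elem n) w = h (eval_list (welded_braid_group n) (wb_elem n) w)"
    if "set w \<subseteq> wb_gens n" for w
    using hom_eval_list[OF group_welded_braid K h, of w "wb_elem n"] that wb_elem_in
    by (metis subsetD)
  moreover have "u \<in> lists (wb_gens n)" "v \<in> lists (wb_gens n)" using uv(2,3) by auto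
  ultimately show ?thesis using wb_relation_holds[OF uv(1)] uv(2,3) by (simp add: comp_def)
qed

text \<open>The relation \<open>\<sigma>\<^sub>i \<sigma>\<^sub>i\<^sub>+\<^sub>1 \<alpha>\<^sub>i = \<alpha>\<^sub>i\<^sub>+\<^sub>1 \<sigma>\<^sub>i \<sigma>\<^sub>i\<^sub>+\<^sub>1\<close> makes each \<open>\<alpha>\<^sub>i\<^sub>+\<^sub>1\<close> a conjugate of \<open>\<alpha>\<^sub>i\<close>
  by an element of the braid subgroup. This reduces the classification to the image of \<open>\<alpha>\<^sub>1\<close>.\<close>

lemma hom_determined_by_sigmas_and_alpha_one:
  assumes K: "group K" and h: "h \<in> hom (welded_braid_group n) K" "h' \<in> hom (welded_braid_group n) K"
    and sig: "\<And>i. 1 \<le> i \<Longrightarrow> i < n \<Longrightarrow> h (wb_elem n (Sigma i)) = h' (wb_elem n (Sigma i))"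
    and al: "h (wb_elem n (Alpha 1)) = h' (wb_elem n (Alpha 1))"
    and g: "g \<in> carrier (welded_braid_group n)"
  shows "h g = h' g"
proof -
  interpret K: group K by (rule K)
  have in_K: "k (wb_elem n x) \<in> carrier K" if "x \<in> wb_gens n" "k \<in> hom (welded_braid_group n) K" for x k
    using that wb_elem_in by (metis hom_in_carrier)
  have alpha: "h (wb_elem n (Alpha i)) = h' (wb_elem n (Alpha i))" if "1 \<le> i" "i < n" for i
    using that
  proof (induction i rule: nat_induct_at_least)
    case base show ?case by (rule al)
  next
    case (Suc i)
    let ?a = "Alpha i" and ?b = "Alpha (Suc i)" and ?s = "Sigma i" and ?t = "Sigma (Suc i)"
    have rel: "([?s, ?t, ?a], [?b, ?s, ?t]) \<in> wb_relations n"
      using Suc by (auto simp: wb_relations_def)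
    have gens: "?a \<in> wb_gens n" "?b \<in> wb_gens n" "?s \<in> wb_gens n" "?t \<in> wb_gens n"
      using Suc by (auto simp: wb_gens_def)
    have r: "k (wb_elem n ?b) = (k (wb_elem n ?s) \<otimes>\<^bsub>K\<^esub> k (wb_elem n ?t) \<otimes>\<^bsub>K\<^esub> k (wb_elem n ?a))
                \<otimes>\<^bsub>K\<^esub> inv\<^bsub>K\<^esub> (k (wb_elem n ?s) \<otimes>\<^bsub>K\<^esub> k (wb_elem n ?t))"
      if k: "k \<in> hom (welded_braid_group n) K" for k
      using hom_wb_relation[OF K k rel] gens in_K[OF _ k]
      by (simp add: K.inv_solve_right K.m_assoc)
    show ?case using r[OF h(1)] r[OF h(2)] sig[of i] sig[of "Suc i"] Suc by simp
  qed
  have "h x = h' x" if "x \<in> wb_elem n ` wb_gens n" for x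
    using that sig alpha by (auto simp: wb_gens_def)
  then show ?thesis
    using hom_eq_on_generate[OF group_welded_braid K h, of "wb_elem n ` wb_gens n"] wb_elem_in g wb_elem_generate
    by blast
qed

section \<open>Burau steps on coordinate sequences\<close>

text \<open>Vectors of dimension \<open>n - 1\<close> are kept as sequences \<open>x\<^sub>1, \<dots>, x\<^sub>n\<^sub>-\<^sub>1\<close> extended by \<open>x\<^sub>0 = x\<^sub>n = 0\<close>. With
  this convention the first and the last generator obey the same formula as the inner ones.\<close>

definition coord_space :: "nat \<Rightarrow> (nat \<Rightarrow> complex) set" where
  "coord_space n = {x. \<forall>i. i = 0 \<or> n \<le> i \<longrightarrow> x i = 0}"

definition unit_coord :: "nat \<Rightarrow> nat \<Rightarrow> complex" where
  "unit_coord j = (\<lambda>i. if i = j then 1 else 0)"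

definition nbr_update ::
  "complex \<Rightarrow> complex \<Rightarrow> complex \<Rightarrow> nat \<Rightarrow> (nat \<Rightarrow> complex) \<Rightarrow> nat \<Rightarrow> complex" where
  "nbr_update a b c i x = x(i := a * x (i - 1) + b * x i + c * x (i + 1))"

abbreviation burau_step :: "complex \<Rightarrow> nat \<Rightarrow> (nat \<Rightarrow> complex) \<Rightarrow> nat \<Rightarrow> complex" where
  "burau_step z \<equiv> nbr_update z (- z) 1"

text \<open>The linear form \<open>f\<^sub>j\<close> for which the reduced Burau generator is \<open>x \<mapsto> x + f\<^sub>j(x) e\<^sub>j\<close>; see
  \<open>burau_step_form\<close>.\<close>

definition burau_form :: "complex \<Rightarrow> nat \<Rightarrow> (nat \<Rightarrow> complex) \<Rightarrow> complex" where
  "burau_form z j x = z * x (j - 1) - (1 + z) * x j + x (j + 1)"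

definition linear_op :: "nat \<Rightarrow> ((nat \<Rightarrow> complex) \<Rightarrow> nat \<Rightarrow> complex) \<Rightarrow> bool" where
  "linear_op n A \<longleftrightarrow>
     (\<forall>x\<in>coord_space n. A x \<in> coord_space n \<and> A x = (\<lambda>i. \<Sum>j=1..<n. x j * A (unit_coord j) i))"

lemma unit_coord_apply: "unit_coord j i = (if i = j then 1 else 0)"
  by (simp add: unit_coord_def)

lemma coord_space_iff: "x \<in> coord_space n \<longleftrightarrow> x 0 = 0 \<and> (\<forall>i\<ge>n. x i = 0)"
  unfolding coord_space_def by blast

lemma coord_spaceI: "x 0 = 0 \<Longrightarrow> (\<And>i. n \<le> i \<Longrightarrow> x i = 0) \<Longrightarrow> x \<in> coord_space n"
  unfolding coord_space_iff by blast

lemma coord_space_0 [simp]: "x \<in> coord_space n \<Longrightarrow> x 0 = 0"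
  unfolding coord_space_iff by blast

lemma coord_space_ge: "x \<in> coord_space n \<Longrightarrow> n \<le> i \<Longrightarrow> x i = 0"
  unfolding coord_space_iff by blast

lemma unit_coord_in [simp]: "1 \<le> j \<Longrightarrow> j < n \<Longrightarrow> unit_coord j \<in> coord_space n"
  by (rule coord_spaceI) (auto simp: unit_coord_apply)

lemma coord_space_comb [simp]:
  "x \<in> coord_space n \<Longrightarrow> y \<in> coord_space n \<Longrightarrow> (\<lambda>i. a * x i + b * y i) \<in> coord_space n"
  by (rule coord_spaceI) (auto simp: coord_space_ge)

lemma nbr_update_in [simp]:
  "x \<in> coord_space n \<Longrightarrow> 1 \<le> i \<Longrightarrow> i < n \<Longrightarrow> nbr_update a b c i x \<in> coord_space n"
  by (rule coord_spaceI) (auto simp: nbr_update_def coord_space_ge)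

lemma linear_op_closed:
  assumes "linear_op n A" "x \<in> coord_space n"
  shows "A x \<in> coord_space n"
  using bspec[OF assms(1)[unfolded linear_op_def] assms(2)] by (rule conjunct1)

lemma linear_op_expand:
  assumes "linear_op n A" "x \<in> coord_space n"
  shows "A x i = (\<Sum>j=1..<n. x j * A (unit_coord j) i)"
proof -
  have "A x = (\<lambda>i. \<Sum>j=1..<n. x j * A (unit_coord j) i)"
    using bspec[OF assms(1)[unfolded linear_op_def] assms(2)] by (rule conjunct2)
  then show ?thesis by (rule fun_cong)
qed

lemma linear_op_comb:
  assumes A: "linear_op n A" and x: "x \<in> coord_space n" and y: "y \<in> coord_space n"
  shows "A (\<lambda>i. a * x i + b * y i) i = a * A x i + b * A y i"
proof -
  have "A (\<lambda>i. a * x i + b * y i) i = (\<Sum>j=1..<n. (a * x j + b * y j) * A (unit_coord j) i)"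
    using linear_op_expand[OF A coord_space_comb[OF x y]] .
  also have "\<dots> = a * (\<Sum>j=1..<n. x j * A (unit_coord j) i) + b * (\<Sum>j=1..<n. y j * A (unit_coord j) i)"
    by (simp only: distrib_right sum.distrib sum_distrib_left mult.assoc)
  finally show ?thesis unfolding linear_op_expand[OF A x] linear_op_expand[OF A y] .
qed

text \<open>Once a linear map is scalar on \<open>e\<^sub>3, e\<^sub>4, \<dots>\<close>, its deviation from that scalar sees only the first two
  coordinates.\<close>

lemma linear_op_two_plus_scalar:
  assumes A: "linear_op n A" and n: "3 \<le> n"
    and sc: "\<And>j i. 3 \<le> j \<Longrightarrow> j < n \<Longrightarrow> A (unit_coord j) i = c * unit_coord j i"
    and x: "x \<in> coord_space n"
  shows "A x i = c * x i + x 1 * (A (unit_coord 1) i - c * unit_coord 1 i)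
                 + x 2 * (A (unit_coord 2) i - c * unit_coord 2 i)"
proof -
  have ivl: "{1..<n} = insert 1 (insert 2 {3..<n})" using n by auto
  have "(\<Sum>j=3..<n. x j * A (unit_coord j) i) = (\<Sum>j=3..<n. if j = i then c * x i else 0)"
    by (rule sum.cong) (simp_all add: sc unit_coord_apply)
  also have "\<dots> = (if i \<in> {3..<n} then c * x i else 0)" by simp
  finally have s: "(\<Sum>j=3..<n. x j * A (unit_coord j) i) = \<dots>" .
  have "(\<Sum>j=1..<n. x j * A (unit_coord j) i) =
      x 1 * A (unit_coord 1) i + (x 2 * A (unit_coord 2) i + (\<Sum>j=3..<n. x j * A (unit_coord j) i))"
    unfolding ivl by simp
  then have val: "A x i = x 1 * A (unit_coord 1) i + (x 2 * A (unit_coord 2) i + (if i \<in> {3..<n} then c * x i else 0))"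
    unfolding s linear_op_expand[OF A x] .
  consider "i = 0 \<or> n \<le> i" | "i = 1" | "i = 2" | "3 \<le> i \<and> i < n" by linarith
  then show ?thesis
  proof cases
    case 1
    then have "x i = 0" using x by (auto simp: coord_space_ge)
    then show ?thesis unfolding val using 1 by (auto simp: unit_coord_apply)
  qed (unfold val, auto simp: unit_coord_apply algebra_simps)
qed

lemma burau_step_form:
  "burau_step z j x = (\<lambda>i. 1 * x i + burau_form z j x * unit_coord j i)"
proof
  fix i
  show "burau_step z j x i = 1 * x i + burau_form z j x * unit_coord j i"
    by (cases "i = j") (simp_all add: nbr_update_def burau_form_def unit_coord_apply algebra_simps)
qed

lemma burau_form_unit:
  assumes "1 \<le> j"
  shows "burau_form z j (unit_coord k) =
    (if k = j then - (1 + z) else if Suc k = j then z else if k = Suc j then 1 else 0)"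
proof -
  obtain m where "j = Suc m" using assms by (cases j) auto
  then show ?thesis by (auto simp: burau_form_def unit_coord_apply)
qed

text \<open>The equation \<open>f\<^sub>j(x) = 0\<close> says \<open>x\<^sub>j\<^sub>+\<^sub>1 - x\<^sub>j = z (x\<^sub>j - x\<^sub>j\<^sub>-\<^sub>1)\<close>. If the first of these differences
  vanishes then all do, so the sequence is constant from there on, with the value \<open>x\<^sub>n = 0\<close>.\<close>

lemma geometric_tail_zero:
  assumes "x \<in> coord_space n" and "x 3 = x 2" and "3 \<le> n"
    and "\<And>j. 3 \<le> j \<Longrightarrow> j < n \<Longrightarrow> burau_form z j x = 0" and "2 \<le> i"
  shows "x i = 0"
proof -
  have step: "x (Suc j) = x j" if "2 \<le> j" "j < n" for j
    using that
  proof (induction j rule: nat_induct_at_least)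
    case base
    have "Suc 2 = (3::nat)" by simp
    then show ?case using assms(2) by metis
  next
    case (Suc m)
    then have "burau_form z (Suc m) x = 0" using assms by simp
    moreover have "x (Suc m) = x m" using Suc by simp
    ultimately show ?case by (simp add: burau_form_def algebra_simps)
  qed
  have const: "x j = x 2" if "2 \<le> j" "j \<le> n" for j
    using that
  proof (induction j rule: nat_induct_at_least)
    case (Suc m)
    then have "x m = x 2" "x (Suc m) = x m" using step[of m] by simp_all
    then show ?case by simp
  qed simp
  have x2: "x 2 = 0" using const[of n] coord_space_ge[OF assms(1) order_refl] assms(3) by simp
  show ?thesis
  proof (cases "i \<le> n")
    case True
    then show ?thesis using const[OF assms(5) True] x2 by simp
  next
    case False
    then show ?thesis using coord_space_ge[OF assms(1), of i] by simp
  qed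
qed

section \<open>The possible images of the first permutation generator\<close>

text \<open>Commuting with \<open>x \<mapsto> x + f\<^sub>j(x) e\<^sub>j\<close> means \<open>f\<^sub>j(x) A e\<^sub>j = f\<^sub>j(A x) e\<^sub>j\<close> for all \<open>x\<close>. The vector
  \<open>e\<^sub>j\<^sub>-\<^sub>1\<close> is used to see that \<open>e\<^sub>j\<close> is an eigenvector, because \<open>f\<^sub>j(e\<^sub>j\<^sub>-\<^sub>1) = z\<close> is nonzero whereas
  \<open>f\<^sub>j(e\<^sub>j) = - (1 + z)\<close> may vanish. Neighbouring eigenvalues agree because \<open>f\<^sub>j(e\<^sub>j\<^sub>+\<^sub>1) = 1\<close>.\<close>

lemma commuting_with_far_steps:
  assumes n: "5 \<le> n" and z: "z \<noteq> 0" and A: "linear_op n A"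
    and invol: "\<And>x. x \<in> coord_space n \<Longrightarrow> A (A x) = x"
    and com: "\<And>j x. 3 \<le> j \<Longrightarrow> j < n \<Longrightarrow> x \<in> coord_space n \<Longrightarrow>
                 A (burau_step z j x) = burau_step z j (A x)"
  shows "\<exists>c. c * c = 1 \<and> (\<forall>j\<in>{3..<n}. A (unit_coord j) = (\<lambda>i. c * unit_coord j i))
           \<and> (\<forall>j\<in>{3..<n}. \<forall>x\<in>coord_space n. burau_form z j (A x) = c * burau_form z j x)"
proof -
  have E: "burau_form z j x * A (unit_coord j) i = burau_form z j (A x) * unit_coord j i"
    if "3 \<le> j" "j < n" "x \<in> coord_space n" for i j x
  proof -
    have "A (burau_step z j x) i = 1 * A x i + burau_form z j x * A (unit_coord j) i"
      unfolding burau_step_form by (rule linear_op_comb[OF A]) (use that in auto)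
    moreover have "burau_step z j (A x) i = A x i + burau_form z j (A x) * unit_coord j i"
      unfolding burau_step_form by simp
    ultimately show ?thesis using com[OF that] by simp
  qed
  define c where "c j = A (unit_coord j) j" for j
  have ev: "A (unit_coord j) = (\<lambda>i. c j * unit_coord j i)" if "3 \<le> j" "j < n" for j
  proof -
    have "z * A (unit_coord j) i = burau_form z j (A (unit_coord (j - 1))) * unit_coord j i" for i
    proof -
      have "burau_form z j (unit_coord (j - 1)) = z"
        using burau_form_unit[of j z "j - 1"] that by auto
      then show ?thesis using E[of j "unit_coord (j - 1)" i] that by simp
    qed
    then have "z * A (unit_coord j) i = 0" if "i \<noteq> j" for i
      using that by (simp add: unit_coord_apply)
    then have "A (unit_coord j) i = 0" if "i \<noteq> j" for i
      using z that by simp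
    then show ?thesis by (auto simp: c_def unit_coord_apply fun_eq_iff)
  qed
  have fm: "burau_form z j (A x) = c j * burau_form z j x"
    if "3 \<le> j" "j < n" "x \<in> coord_space n" for j x
    using E[OF that, of j] by (simp add: unit_coord_apply c_def mult.commute)
  have c_step: "c (Suc j) = c j" if "3 \<le> j" "Suc j < n" for j
  proof -
    have "burau_form z j (A (unit_coord (Suc j))) = c (Suc j) * burau_form z j (unit_coord (Suc j))"
      using ev[of "Suc j"] that by (simp add: burau_form_def algebra_simps)
    then show ?thesis
      using fm[of j "unit_coord (Suc j)"] burau_form_unit[of j z "Suc j"] that by simp
  qed
  have const: "c j = c 3" if "3 \<le> j" "j < n" for j
    using that
  proof (induction j rule: nat_induct_at_least)
    case (Suc m)
    then show ?case using c_step[of m] by simp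
  qed simp
  have "c 3 * c 3 = 1"
  proof -
    have "A (A (unit_coord 3)) 3 = A (\<lambda>i. c 3 * unit_coord 3 i + 0 * unit_coord 3 i) 3"
      using arg_cong[OF ev[of 3], of "\<lambda>x. A x 3"] n by simp
    also have "\<dots> = c 3 * A (unit_coord 3) 3 + 0 * A (unit_coord 3) 3"
      by (rule linear_op_comb[OF A]) (use n in auto)
    also have "\<dots> = c 3 * c 3" by (simp add: c_def)
    finally have "A (A (unit_coord 3)) 3 = c 3 * c 3" .
    then show ?thesis using invol[of "unit_coord 3"] n by (simp add: unit_coord_apply)
  qed
  moreover have "\<forall>j\<in>{3..<n}. A (unit_coord j) = (\<lambda>i. c 3 * unit_coord j i)"
  proof
    fix j assume "j \<in> {3..<n}"
    then have j: "3 \<le> j" "j < n" by auto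
    show "A (unit_coord j) = (\<lambda>i. c 3 * unit_coord j i)"
      using ev[OF j] unfolding const[OF j] .
  qed
  moreover have "\<forall>j\<in>{3..<n}. \<forall>x\<in>coord_space n. burau_form z j (A x) = c 3 * burau_form z j x"
  proof (intro ballI)
    fix j x assume "j \<in> {3..<n}" and x: "x \<in> coord_space n"
    then have j: "3 \<le> j" "j < n" by auto
    show "burau_form z j (A x) = c 3 * burau_form z j x"
      using fm[OF j x] unfolding const[OF j] .
  qed
  ultimately show ?thesis by (intro exI conjI)
qed

text \<open>Pure algebra behind the second coordinate of \<open>(A\<^sub>3 - c) e\<^sub>3\<close> and \<open>(A\<^sub>3 - c) e\<^sub>4\<close> in
  \<open>alpha_one_dichotomy\<close>; \<open>u2, u3, u4\<close> are coordinates of a vector killed by \<open>f\<^sub>3\<close>.\<close>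

lemma shifted_coordinate_ratio:
  fixes z :: complex
  assumes "z \<noteq> 0" "z\<^sup>2 * p1 = u3 - u2" "z\<^sup>2 * p1 - z\<^sup>2 * p2 + p4 = t" "p4 - t = u4 - u3"
    "z * u2 - (1 + z) * u3 + u4 = 0"
  shows "p2 = (1 + z) * p1"
proof -
  have "z\<^sup>2 * p2 = z\<^sup>2 * ((1 + z) * p1)" using assms by Groebner_Basis.algebra
  then show ?thesis using assms(1) by simp
qed

text \<open>Cancels the \<open>i\<close>-th coordinate \<open>e\<close> of \<open>e\<^sub>2\<close> in \<open>A\<^sub>1\<^sup>2 e\<^sub>2 = e\<^sub>2\<close> when \<open>A\<^sub>1 x = c x + f\<^sub>1(x) w\<close>.\<close>

lemma involution_coefficient:
  fixes c :: complex
  assumes "c * (c * e + w) + (c + f) * w = e" "c * c = 1"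
  shows "(2 * c + f) * w = 0"
proof -
  have "(2 * c + f) * w = c * (c * e + w) + (c + f) * w - (c * c) * e" by (simp add: algebra_simps)
  then show ?thesis using assms by simp
qed

text \<open>After substitution the hypothesis is \<open>- (z F - c)\<^sup>2 = 0\<close>: the relation that mixes both kinds of
  generators has a double root, which is why it leaves exactly one solution.\<close>

lemma square_coefficient:
  fixes c :: complex
  assumes "c * c + c * f + g * F = 0" and g: "g = - z * f - z\<^sup>2 * F" and f: "f = - 2 * c"
  shows "z * F = c"
proof -
  have "(z * F - c)\<^sup>2 = - (c * c + c * f + g * F)"
    unfolding g f by (simp add: power2_eq_square algebra_simps)
  then show ?thesis using assms(1) by simp
qed

text \<open>The hypotheses are the first two coordinates of the mixed relation at \<open>e\<^sub>3\<close>, with \<open>g = f\<^sub>2(w)\<close>; the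
  conclusion is \<open>c\<^sup>2 + c f\<^sub>1(w) + f\<^sub>2(w) f\<^sub>1(v) = 0\<close>.\<close>

lemma mixed_coefficient:
  fixes z :: complex
  assumes "- z * (c * v1) + c * v2 = c * w1 + (- c * z + g) * v1"
    and "c * v2 = c * (c + w2) + (- c * z + g) * v2"
  shows "c * c + c * (- (1 + z) * w1 + w2) + g * (- (1 + z) * v1 + v2) = 0"
  using assms by Groebner_Basis.algebra

text \<open>Here \<open>A\<^sub>i\<close> stands for the transpose of the image of \<open>\<alpha>\<^sub>i\<close>, so every relation of the group appears
  with its words reversed. Write \<open>A\<^sub>1 = c + M\<close> with \<open>u = M e\<^sub>1\<close>, \<open>w = M e\<^sub>2\<close> and \<open>M e\<^sub>j = 0\<close> for
  \<open>j \<ge> 3\<close>; both vectors are killed by \<open>f\<^sub>3, f\<^sub>4, \<dots>\<close>. The shift relations express \<open>A\<^sub>2\<close> and \<open>A\<^sub>3\<close>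
  through \<open>A\<^sub>1\<close>. If \<open>p\<close> is \<open>A\<^sub>3 e\<^sub>3\<close>, then commutation of \<open>A\<^sub>1\<close> and \<open>A\<^sub>3\<close> gives \<open>M p = 0\<close>, that is
  \<open>p\<^sub>1 u + p\<^sub>2 w = 0\<close>, and one computes \<open>p\<^sub>2 = (1 + z) p\<^sub>1\<close> and \<open>z\<^sup>2 p\<^sub>1 = u\<^sub>3 - u\<^sub>2\<close>. The same holds for
  \<open>e\<^sub>4\<close> and \<open>w\<close>, and it is for \<open>e\<^sub>4\<close> that \<open>n \<ge> 5\<close> is required. So either \<open>u\<close> and \<open>w\<close> have equal second
  and third coordinates, whence they are multiples of \<open>e\<^sub>1\<close>, or \<open>u = - (1 + z) w\<close>, whence
  \<open>M x = f\<^sub>1(x) w\<close>. In both cases \<open>M\<close> has rank at most one, and \<open>A\<^sub>1\<^sup>2 = 1\<close> together with the mixed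
  relation evaluated at \<open>e\<^sub>3\<close> determines the remaining scalars.\<close>

lemma alpha_one_dichotomy:
  assumes n: "5 \<le> n" and z: "z \<noteq> 0"
    and A1: "linear_op n A1" and A2: "linear_op n A2" and A3: "linear_op n A3"
    and invol: "\<And>x. x \<in> coord_space n \<Longrightarrow> A1 (A1 x) = x"
    and com: "\<And>j x. 3 \<le> j \<Longrightarrow> j < n \<Longrightarrow> x \<in> coord_space n \<Longrightarrow>
                 A1 (burau_step z j x) = burau_step z j (A1 x)"
    and shift12: "\<And>x. x \<in> coord_space n \<Longrightarrow>
                 A1 (burau_step z 2 (burau_step z 1 x)) = burau_step z 2 (burau_step z 1 (A2 x))"
    and shift23: "\<And>x. x \<in> coord_space n \<Longrightarrow>
                 A2 (burau_step z 3 (burau_step z 2 x)) = burau_step z 3 (burau_step z 2 (A3 x))"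
    and com13: "\<And>x. x \<in> coord_space n \<Longrightarrow> A1 (A3 x) = A3 (A1 x)"
    and mixed: "\<And>x. x \<in> coord_space n \<Longrightarrow>
                 burau_step z 1 (A2 (A1 x)) = A2 (A1 (burau_step z 2 x))"
  obtains c where "c = 1 \<or> c = -1"
      and "\<And>x. x \<in> coord_space n \<Longrightarrow>
             A1 x = (\<lambda>i. c * (x i + (- 2 * x 1 + x 2 / z) * unit_coord 1 i))"
    | c u where "c = 1 \<or> c = -1" and "u \<in> coord_space n"
      and "burau_form z 1 u = - 2" and "burau_form z 2 u = z"
      and "\<And>j. 3 \<le> j \<Longrightarrow> j < n \<Longrightarrow> burau_form z j u = 0"
      and "\<And>x. x \<in> coord_space n \<Longrightarrow> A1 x = (\<lambda>i. c * (x i + burau_form z 1 x * u i))"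
proof -
  note One_nat_def [simp del]
  let ?V = "coord_space n" and ?e = unit_coord and ?f = "burau_form z" and ?S = "burau_step z"
  have "\<exists>c. c * c = 1 \<and> (\<forall>j\<in>{3..<n}. A1 (?e j) = (\<lambda>i. c * ?e j i))
           \<and> (\<forall>j\<in>{3..<n}. \<forall>x\<in>?V. ?f j (A1 x) = c * ?f j x)"
    by (rule commuting_with_far_steps[OF n z A1]) (fact invol, fact com)
  then obtain c where cc: "c * c = 1"
    and ev_all: "\<forall>j\<in>{3..<n}. A1 (?e j) = (\<lambda>i. c * ?e j i)"
    and fm_all: "\<forall>j\<in>{3..<n}. \<forall>x\<in>?V. ?f j (A1 x) = c * ?f j x"
    by (elim exE conjE)
  have ev: "A1 (?e j) = (\<lambda>i. c * ?e j i)" if "3 \<le> j" "j < n" for j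
    using bspec[OF ev_all, of j] that by simp
  have fm: "?f j (A1 x) = c * ?f j x" if "3 \<le> j" "j < n" "x \<in> ?V" for j x
    using bspec[OF bspec[OF fm_all, of j] that(3)] that by simp
  have c: "c = 1 \<or> c = -1" using cc by (metis square_eq_1_iff)
  define u where "u = (\<lambda>i. A1 (?e 1) i - c * ?e 1 i)"
  define w where "w = (\<lambda>i. A1 (?e 2) i - c * ?e 2 i)"
  have A1x: "A1 x i = c * x i + x 1 * u i + x 2 * w i" if "x \<in> ?V" for x i
    using linear_op_two_plus_scalar[OF A1 _ _ that, of c i] n ev unfolding u_def w_def by simp
  have uV: "u \<in> ?V" and wV: "w \<in> ?V"
    using coord_space_comb[OF linear_op_closed[OF A1, of "?e 1"], of "?e 1" 1 "- c"]
      coord_space_comb[OF linear_op_closed[OF A1, of "?e 2"], of "?e 2" 1 "- c"] n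
    by (simp_all add: u_def w_def)
  have fu: "?f j u = 0" and fw: "?f j w = 0" if "3 \<le> j" "j < n" for j
    using fm[OF that, of "?e 1"] fm[OF that, of "?e 2"] that
    by (auto simp: burau_form_def u_def w_def algebra_simps)
  have S1: "?S 1 y i = (if i = 1 then z * y 0 - z * y 1 + y 2 else y i)" for y i
    by (cases "i = 1") (simp_all add: nbr_update_def numeral_eq_Suc One_nat_def)
  have S2: "?S 2 y i = (if i = 2 then z * y 1 - z * y 2 + y 3 else y i)" for y i
    by (cases "i = 2") (simp_all add: nbr_update_def numeral_eq_Suc One_nat_def)
  have S3: "?S 3 y i = (if i = 3 then z * y 2 - z * y 3 + y 4 else y i)" for y i
    by (cases "i = 3") (simp_all add: nbr_update_def numeral_eq_Suc One_nat_def)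
  \<comment> \<open>\<open>T\<close> and \<open>T'\<close> give the transposes of \<open>\<sigma>\<^sub>1 \<sigma>\<^sub>2\<close> and \<open>\<sigma>\<^sub>2 \<sigma>\<^sub>3\<close>, which conjugate \<open>A\<^sub>1\<close> to \<open>A\<^sub>2\<close> and \<open>A\<^sub>2\<close> to \<open>A\<^sub>3\<close>.\<close>
  have T: "?S 2 (?S 1 y) = (\<lambda>i. if i = 1 then - z * y 1 + y 2 else if i = 2 then - z\<^sup>2 * y 1 + y 3 else y i)"
    if "y \<in> ?V" for y
    using that by (simp add: fun_eq_iff S1 S2 power2_eq_square algebra_simps)
  have T': "?S 3 (?S 2 y) = (\<lambda>i. if i = 2 then z * y 1 - z * y 2 + y 3
                else if i = 3 then z\<^sup>2 * y 1 - z\<^sup>2 * y 2 + y 4 else y i)"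
    for y
    by (simp add: fun_eq_iff S2 S3 power2_eq_square algebra_simps)
  have Tinj: "y = y'" if "y \<in> ?V" "y' \<in> ?V" "?S 2 (?S 1 y) = ?S 2 (?S 1 y')" for y y'
  proof -
    have eq: "(if i = 1 then - z * y 1 + y 2 else if i = 2 then - z\<^sup>2 * y 1 + y 3 else y i)
      = (if i = 1 then - z * y' 1 + y' 2 else if i = 2 then - z\<^sup>2 * y' 1 + y' 3 else y' i)" for i
      using fun_cong[OF that(3), of i] unfolding T[OF that(1)] T[OF that(2)] .
    have 3: "y 3 = y' 3" using eq[of 3] by simp
    then have 1: "y 1 = y' 1" using eq[of 2] z by simp
    then have 2: "y 2 = y' 2" using eq[of 1] by simp
    have "y i = y' i" for i using eq[of i] 1 2 by (cases "i = 1 \<or> i = 2") auto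
    then show ?thesis by blast
  qed
  have eV: "?e 1 \<in> ?V" "?e 2 \<in> ?V" "?e 3 \<in> ?V" "?e 4 \<in> ?V" using n by auto
  have A2V: "A2 x \<in> ?V" if "x \<in> ?V" for x using linear_op_closed[OF A2 that] .
  have A3V: "A3 x \<in> ?V" if "x \<in> ?V" for x using linear_op_closed[OF A3 that] .
  have TA2: "(if i = 1 then - z * A2 x 1 + A2 x 2 else if i = 2 then - z\<^sup>2 * A2 x 1 + A2 x 3 else A2 x i)
     = c * (if i = 1 then - z * x 1 + x 2 else if i = 2 then - z\<^sup>2 * x 1 + x 3 else x i)
       + (x 2 - z * x 1) * u i + (x 3 - z\<^sup>2 * x 1) * w i" if "x \<in> ?V" for x i
  proof -
    have "?S 2 (?S 1 x) \<in> ?V" using that n by simp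
    from A1x[OF this, of i] show ?thesis
      using fun_cong[OF shift12[OF that], of i] unfolding T[OF that] T[OF A2V[OF that]] by simp
  qed
  define y where "y = A2 (?e 2)"
  define y' where "y' = A2 (?e 3)"
  have yi: "y i = u i" and y'i: "y' i = c * ?e 3 i + w i" if "3 \<le> i" for i
    using TA2[OF eV(2), of i] TA2[OF eV(3), of i] that by (auto simp: y_def y'_def unit_coord_apply)
  have y1: "z\<^sup>2 * y 1 = u 3 - u 2" 
    using TA2[OF eV(2), of 2] TA2[OF eV(2), of 3] by (simp add: y_def unit_coord_apply algebra_simps)
  have y'1: "z\<^sup>2 * y' 1 = w 3 - w 2" 
    using TA2[OF eV(3), of 2] TA2[OF eV(3), of 3] by (simp add: y'_def unit_coord_apply algebra_simps)
  have A2e4: "A2 (?e 4) = (\<lambda>i. c * ?e 4 i)"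
  proof (rule Tinj)
    show "A2 (?e 4) \<in> ?V" "(\<lambda>i. c * ?e 4 i) \<in> ?V"
      using A2V[OF eV(4)] coord_space_comb[OF eV(4) eV(4), of c 0] by auto
    then show "?S 2 (?S 1 (A2 (?e 4))) = ?S 2 (?S 1 (\<lambda>i. c * ?e 4 i))"
      using TA2[OF eV(4)] by (simp add: T fun_eq_iff unit_coord_apply)
  qed
  define p where "p = A3 (?e 3)"
  define q where "q = A3 (?e 4)"
  have T'p: "?S 3 (?S 2 p) = y"
  proof -
    have "?S 3 (?S 2 (?e 3)) = ?e 2" by (simp add: T' unit_coord_apply fun_eq_iff)
    then show ?thesis using shift23[OF eV(3)] by (simp add: p_def y_def)
  qed
  have T'q: "?S 3 (?S 2 q) i = y' i + c * ?e 4 i" for i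
  proof -
    have "?S 3 (?S 2 (?e 4)) = (\<lambda>i. 1 * ?e 3 i + 1 * ?e 4 i)" by (auto simp: T' unit_coord_apply fun_eq_iff)
    then show ?thesis using shift23[OF eV(4)] linear_op_comb[OF A2 eV(3) eV(4), of 1 1 i] A2e4
      by (simp add: q_def y'_def)
  qed
  have f3: "z * u 2 - (1 + z) * u 3 + u 4 = 0" "z * w 2 - (1 + z) * w 3 + w 4 = 0"
    using fu[of 3] fw[of 3] n by (auto simp: burau_form_def)
  have p: "p 1 = y 1" "z\<^sup>2 * p 1 - z\<^sup>2 * p 2 + p 4 = u 3" "p 4 = u 4"
    using fun_cong[OF T'p, of 1] fun_cong[OF T'p, of 3] fun_cong[OF T'p, of 4] yi[of 3] yi[of 4]
    by (auto simp: T')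
  have q: "q 1 = y' 1" "z\<^sup>2 * q 1 - z\<^sup>2 * q 2 + q 4 = c + w 3" "q 4 = c + w 4"
    using T'q[of 1] T'q[of 3] T'q[of 4] y'i[of 3] y'i[of 4]
    by (auto simp: T' unit_coord_apply)
  have p2: "p 2 = (1 + z) * p 1"
    by (rule shifted_coordinate_ratio[OF z _ p(2) _ f3(1)]) (use p y1 in auto)
  have q2: "q 2 = (1 + z) * q 1"
    by (rule shifted_coordinate_ratio[OF z _ q(2) _ f3(2)]) (use q y'1 in auto)
  have van: "p 1 * (u i + (1 + z) * w i) = 0" "q 1 * (u i + (1 + z) * w i) = 0" for i
  proof -
    have "A1 p i = c * p i" 
      using com13[OF eV(3)] ev[of 3] n linear_op_comb[OF A3 eV(3) eV(3), of c 0 i] by (simp add: p_def)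
    then show "p 1 * (u i + (1 + z) * w i) = 0"
      using A1x[of p i] A3V[OF eV(3)] p2 by (simp add: p_def[symmetric] algebra_simps)
    have "A1 q i = c * q i" 
      using com13[OF eV(4)] ev[of 4] n linear_op_comb[OF A3 eV(4) eV(4), of c 0 i] by (simp add: q_def)
    then show "q 1 * (u i + (1 + z) * w i) = 0"
      using A1x[of q i] A3V[OF eV(4)] q2 by (simp add: q_def[symmetric] algebra_simps)
  qed
  show thesis
  proof (cases "\<forall>i. u i + (1 + z) * w i = 0")
    case False
    then have "p 1 = 0" "q 1 = 0" using van by auto
    then have y0: "y 1 = 0" "y' 1 = 0" and "u 3 = u 2" "w 3 = w 2" using p q y1 y'1 by auto
    then have ui: "u i = 0" and wi: "w i = 0" if "2 \<le> i" for i
      using geometric_tail_zero[OF uV _ _ fu that] geometric_tail_zero[OF wV _ _ fw that] n by auto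
    \<comment> \<open>The first coordinates of \<open>A\<^sub>1\<^sup>2 e\<^sub>1 = e\<^sub>1\<close> and \<open>A\<^sub>1\<^sup>2 e\<^sub>2 = e\<^sub>2\<close>.\<close>
    have sq: "c * u 1 + u 1 * (c + u 1) = 0" "c * w 1 + w 1 * (c + u 1) = 0"
    proof -
      have a: "A1 (?e 1) i = c * ?e 1 i + u i" "A1 (?e 2) i = c * ?e 2 i + w i" for i
        by (auto simp: u_def w_def)
      have "A1 (A1 (?e 1)) 1 = 1" "A1 (A1 (?e 2)) 1 = 0"
        using invol[OF eV(1)] invol[OF eV(2)] by (auto simp: unit_coord_apply)
      then show "c * u 1 + u 1 * (c + u 1) = 0" "c * w 1 + w 1 * (c + u 1) = 0"
        using A1x[of "A1 (?e 1)" 1] A1x[of "A1 (?e 2)" 1] linear_op_closed[OF A1] eV cc ui[of 2] wi[of 2]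
        by (auto simp: a unit_coord_apply algebra_simps)
    qed
    define g where "g = A2 (?e 1)"
    have g2: "g 2 = - z * u 1 - z\<^sup>2 * w 1"
    proof -
      have "g 3 = 0" "- z\<^sup>2 * g 1 + g 3 = - z\<^sup>2 * c" "- z * g 1 + g 2 = - z * c - z * u 1 - z\<^sup>2 * w 1"
        using TA2[OF eV(1), of 3] TA2[OF eV(1), of 2] TA2[OF eV(1), of 1] ui[of 2] ui[of 3] wi[of 2] wi[of 3]
        by (auto simp: g_def unit_coord_apply algebra_simps)
      then show ?thesis using z by auto
    qed
    have y2: "y 2 = c + u 1" using TA2[OF eV(2), of 1] y0 by (simp add: y_def unit_coord_apply)
    \<comment> \<open>The second coordinate of the mixed relation at \<open>e\<^sub>3\<close>.\<close>
    have "c * y 2 + w 1 * g 2 = 0"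
    proof -
      have 1: "A2 (A1 (?e 3)) i = c * y' i" for i
        using ev[of 3] n linear_op_comb[OF A2 eV(3) eV(3), of c 0 i] by (simp add: y'_def)
      have s: "?S 2 (?e 3) = (\<lambda>i. 1 * ?e 2 i + 1 * ?e 3 i)"
        by (auto simp: nbr_update_def unit_coord_apply fun_eq_iff)
      have A1s: "A1 (?S 2 (?e 3)) = (\<lambda>i. 1 * (c * ?e 2 i + w 1 * ?e 1 i) + c * ?e 3 i)"
      proof
        fix i
        have "w i = w 1 * ?e 1 i"
          using wi[of i] wV by (cases "i = 0 \<or> i = 1") (auto simp: unit_coord_apply)
        then show "A1 (?S 2 (?e 3)) i = 1 * (c * ?e 2 i + w 1 * ?e 1 i) + c * ?e 3 i"
          using A1x[OF coord_space_comb[OF eV(2) eV(3), of 1 1], of i] unfolding s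
          by (simp add: unit_coord_apply algebra_simps)
      qed
      have "A2 (A1 (?S 2 (?e 3))) 2 = c * y 2 + w 1 * g 2 + c * y' 2"
        unfolding A1s
        unfolding linear_op_comb[OF A2 coord_space_comb[OF eV(2) eV(1)] eV(3)]
          linear_op_comb[OF A2 eV(2) eV(1)]
        by (simp add: y_def y'_def g_def)
      moreover have "?S 1 (A2 (A1 (?e 3))) 2 = c * y' 2" by (simp add: nbr_update_def 1)
      ultimately show ?thesis using mixed[OF eV(3)] by simp
    qed
    then have key: "c * (c + u 1) - w 1 * (z * u 1 + z\<^sup>2 * w 1) = 0"
      unfolding y2 g2 by (simp add: algebra_simps)
    have u1: "u 1 = - 2 * c"
    proof (rule ccontr)
      assume "u 1 \<noteq> - 2 * c"
      then have ne: "2 * c + u 1 \<noteq> 0" by Groebner_Basis.algebra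
      have "w 1 * (2 * c + u 1) = 0" "u 1 * (2 * c + u 1) = 0" using sq by Groebner_Basis.algebra+
      then have "w 1 = 0" "u 1 = 0" using ne by auto
      then show False using key cc by simp
    qed
    have "(z * w 1 - c)\<^sup>2 = 0" using key u1 cc by Groebner_Basis.algebra
    then have w1: "w 1 = c / z" using z by (simp add: field_simps)
    have "A1 x = (\<lambda>i. c * (x i + (- 2 * x 1 + x 2 / z) * ?e 1 i))" if "x \<in> ?V" for x
    proof
      fix i
      show "A1 x i = c * (x i + (- 2 * x 1 + x 2 / z) * ?e 1 i)"
      proof (cases "i = 1")
        case True then show ?thesis using A1x[OF that, of i] u1 w1 z by (simp add: unit_coord_apply field_simps)
      next
        case False
        then have "u i = 0" "w i = 0" using ui[of i] wi[of i] uV wV by (cases "i = 0"; auto)+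
        then show ?thesis using A1x[OF that, of i] False by (simp add: unit_coord_apply)
      qed
    qed
    then show thesis using that(1)[OF c] by blast
  next
    case True
    have uw: "u i = - (1 + z) * w i" for i
      using spec[OF True, of i] by (simp add: eq_neg_iff_add_eq_0 minus_mult_left[symmetric] del: minus_add_distrib)
    have f1: "?f 1 x = - (1 + z) * x 1 + x 2" if "x \<in> ?V" for x
      using that by (simp add: burau_form_def algebra_simps)
    have f2: "?f 2 x = z * x 1 - (1 + z) * x 2 + x 3" for x
      by (simp add: burau_form_def One_nat_def)
    have A1w: "A1 x i = c * x i + ?f 1 x * w i" if "x \<in> ?V" for x i
      unfolding A1x[OF that, of i] uw[of i] f1[OF that] by (simp add: algebra_simps)
    \<comment> \<open>\<open>v\<close> is the vector with \<open>A\<^sub>2 x = c x + f\<^sub>2(x) v\<close>, the counterpart of \<open>w\<close> for \<open>A\<^sub>2\<close>.\<close>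
    define v where "v = (\<lambda>i. y' i - c * ?e 3 i)"
    have vV: "v \<in> ?V" using coord_space_comb[OF A2V[OF eV(3)] eV(3), of 1 "- c"] by (simp add: v_def y'_def)
    have Tv: "(if i = 1 then - z * v 1 + v 2 else if i = 2 then - z\<^sup>2 * v 1 + v 3 else v i) = w i" for i
      using TA2[OF eV(3), of i] by (auto simp: v_def y'_def unit_coord_apply algebra_simps)
    have A2v: "A2 x i = c * x i + ?f 2 x * v i" if "x \<in> ?V" for x i
    proof -
      have "A2 x = (\<lambda>i. c * x i + ?f 2 x * v i)"
      proof (rule Tinj)
        show 1: "A2 x \<in> ?V" "(\<lambda>i. c * x i + ?f 2 x * v i) \<in> ?V" using A2V that vV by auto
        show "?S 2 (?S 1 (A2 x)) = ?S 2 (?S 1 (\<lambda>i. c * x i + ?f 2 x * v i))"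
          unfolding T[OF 1(1)] T[OF 1(2)]
        proof
          fix i
          have "(x 2 - z * x 1) * u i + (x 3 - z\<^sup>2 * x 1) * w i = ?f 2 x * w i"
            unfolding uw[of i] f2 by (simp add: algebra_simps power2_eq_square)
          then show "(if i = 1 then - z * A2 x 1 + A2 x 2 else if i = 2 then - z\<^sup>2 * A2 x 1 + A2 x 3 else A2 x i)
            = (if i = 1 then - z * (c * x 1 + ?f 2 x * v 1) + (c * x 2 + ?f 2 x * v 2)
               else if i = 2 then - z\<^sup>2 * (c * x 1 + ?f 2 x * v 1) + (c * x 3 + ?f 2 x * v 3)
               else c * x i + ?f 2 x * v i)"
            unfolding TA2[OF that, of i] add.assoc using Tv[of i, symmetric]
            by (simp add: algebra_simps)
        qed
      qed
      then show ?thesis by simp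
    qed
    define F where "F = ?f 1 v"
    \<comment> \<open>From \<open>w = T v\<close>, \<open>f\<^sub>1 \<circ> T = f\<^sub>2\<close> and \<open>f\<^sub>2 \<circ> T = - z f\<^sub>2 - z\<^sup>2 f\<^sub>1\<close>.\<close>
    have fw1: "?f 1 w = ?f 2 v" and fw2: "?f 2 w = - z * ?f 1 w - z\<^sup>2 * F"
    proof -
      have t: "w 1 = - z * v 1 + v 2" "w 2 = - z\<^sup>2 * v 1 + v 3" "w 3 = v 3"
        using Tv[of 1] Tv[of 2] Tv[of 3] by simp_all
      show "?f 1 w = ?f 2 v" "?f 2 w = - z * ?f 1 w - z\<^sup>2 * F"
        unfolding F_def f1[OF wV] f1[OF vV] f2 t by (simp_all add: algebra_simps power2_eq_square)
    qed
    have w2c: "(2 * c + ?f 1 w) * w i = 0" for i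
    proof -
      have "A1 (A1 (?e 2)) i = ?e 2 i" using invol[OF eV(2)] by simp
      moreover have a: "A1 (?e 2) j = c * ?e 2 j + w j" for j
        using A1w[OF eV(2), of j] f1[OF eV(2)] by (simp add: unit_coord_apply)
      moreover have "?f 1 (A1 (?e 2)) = c + ?f 1 w"
        unfolding f1[OF linear_op_closed[OF A1 eV(2)]] f1[OF wV] a
        by (simp add: unit_coord_apply algebra_simps)
      ultimately have "c * (c * ?e 2 i + w i) + (c + ?f 1 w) * w i = ?e 2 i"
        using A1w[of "A1 (?e 2)" i] linear_op_closed[OF A1 eV(2)] by simp
      then show ?thesis using involution_coefficient cc by blast
    qed
    \<comment> \<open>The mixed relation at \<open>e\<^sub>3\<close>, after application of \<open>f\<^sub>1\<close>.\<close>
    have eqn: "c * c + c * ?f 1 w + ?f 2 w * F = 0"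
    proof -
      have s: "?S 2 (?e 3) = (\<lambda>i. 1 * ?e 2 i + 1 * ?e 3 i)"
        by (auto simp: nbr_update_def unit_coord_apply fun_eq_iff)
      have sV: "?S 2 (?e 3) \<in> ?V" using eV n by simp
      have a: "A1 (?S 2 (?e 3)) i = c * (?e 2 i + ?e 3 i) + w i" for i
        using A1w[OF sV, of i] f1[OF sV] s by (simp add: unit_coord_apply)
      have aV: "A1 (?S 2 (?e 3)) \<in> ?V" using linear_op_closed[OF A1 sV] .
      have b: "?f 2 (A1 (?S 2 (?e 3))) = - c * z + ?f 2 w"
        unfolding f2 a by (simp add: unit_coord_apply algebra_simps)
      have r: "A2 (A1 (?S 2 (?e 3))) i = c * (c * (?e 2 i + ?e 3 i) + w i) + (- c * z + ?f 2 w) * v i" for i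
        using A2v[OF aV, of i] a b by simp
      have l: "A2 (A1 (?e 3)) i = c * (c * ?e 3 i + v i)" for i
        using ev[of 3] n linear_op_comb[OF A2 eV(3) eV(3), of c 0 i] by (simp add: v_def y'_def)
      note m = fun_cong[OF mixed[OF eV(3)]]
      have m1: "- z * (c * v 1) + c * v 2 = c * w 1 + (- c * z + ?f 2 w) * v 1"
        using m[of 1] vV by (simp add: S1 r l unit_coord_apply)
      have m2: "c * v 2 = c * (c + w 2) + (- c * z + ?f 2 w) * v 2"
        using m[of 2] by (simp add: S1 r l unit_coord_apply)
      show ?thesis
        unfolding F_def f1[OF wV] f1[OF vV] using mixed_coefficient[OF m1 m2] .
    qed
    have fw1c: "?f 1 w = - 2 * c"
    proof (rule ccontr)
      assume "?f 1 w \<noteq> - 2 * c"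
      then have "2 * c + ?f 1 w \<noteq> 0" by Groebner_Basis.algebra
      then have "w i = 0" for i using w2c by simp
      then show False using eqn cc by (simp add: burau_form_def)
    qed
    have zF: "z * F = c" by (rule square_coefficient[OF eqn fw2 fw1c])
    have "?f 2 w = z * (2 * c) - z * (z * F)" unfolding fw2 fw1c by (simp add: power2_eq_square)
    then have fw2c: "?f 2 w = c * z" unfolding zF by (simp add: algebra_simps)
    have fs: "?f j (\<lambda>i. c * w i) = c * ?f j w" for j by (simp add: burau_form_def algebra_simps)
    show thesis
    proof (rule that(2)[OF c, of "\<lambda>i. c * w i"])
      show "(\<lambda>i. c * w i) \<in> ?V" using coord_space_comb[OF wV wV, of c 0] by simp
      show "?f 1 (\<lambda>i. c * w i) = - 2" "?f 2 (\<lambda>i. c * w i) = z"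
        using fs fw1c fw2c cc by (auto simp: algebra_simps) 
      show "?f j (\<lambda>i. c * w i) = 0" if "3 \<le> j" "j < n" for j using fs fw that by simp
      show "A1 x = (\<lambda>i. c * (x i + ?f 1 x * (c * w i)))" if "x \<in> ?V" for x
      proof
        fix i show "A1 x i = c * (x i + ?f 1 x * (c * w i))"
          using A1w[OF that, of i] cc by Groebner_Basis.algebra
      qed
    qed
  qed
qed

section \<open>Matrices acting on coordinate sequences\<close>

definition act :: "nat \<Rightarrow> complex mat \<Rightarrow> (nat \<Rightarrow> complex) \<Rightarrow> nat \<Rightarrow> complex" where
  "act n A x = (\<lambda>i. if 0 < i \<and> i < n then \<Sum>k<n - 1. A $$ (i - 1, k) * x (Suc k) else 0)"

lemma act_apply: "0 < i \<Longrightarrow> i < n \<Longrightarrow> act n A x i = (\<Sum>k<n - 1. A $$ (i - 1, k) * x (Suc k))"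
  by (simp add: act_def)

lemma act_outside: "\<not> (0 < i \<and> i < n) \<Longrightarrow> act n A x i = 0"
  unfolding act_def by presburger

lemma act_in [simp]: "act n A x \<in> coord_space n"
  by (rule coord_spaceI) (auto simp: act_outside)

lemma act_unit_coord:
  assumes "1 \<le> j" "j < n"
  shows "act n A (unit_coord j) i = (if 0 < i \<and> i < n then A $$ (i - 1, j - 1) else 0)"
proof -
  have "(\<Sum>k<n - 1. A $$ (i - 1, k) * unit_coord j (Suc k)) = (\<Sum>k<n - 1. if k = j - 1 then A $$ (i - 1, j - 1) else 0)"
    by (rule sum.cong) (use assms in \<open>auto simp: unit_coord_apply\<close>)
  also have "\<dots> = A $$ (i - 1, j - 1)" using assms by simp
  finally show ?thesis by (simp add: act_def)
qed

lemma linear_op_act: "linear_op n (act n A)"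
  unfolding linear_op_def
proof (intro ballI conjI)
  fix x assume "x \<in> coord_space n"
  show "act n A x = (\<lambda>i. \<Sum>j=1..<n. x j * act n A (unit_coord j) i)"
  proof
    fix i
    show "act n A x i = (\<Sum>j=1..<n. x j * act n A (unit_coord j) i)"
    proof (cases "0 < i \<and> i < n")
      case True
      have "(\<Sum>j=1..<n. x j * act n A (unit_coord j) i) = (\<Sum>j=1..<n. A $$ (i - 1, j - 1) * x j)"
        by (rule sum.cong) (use True in \<open>auto simp: act_unit_coord\<close>)
      also have "\<dots> = (\<Sum>k<n - 1. A $$ (i - 1, k) * x (Suc k))"
        by (rule sum.reindex_bij_witness[of _ Suc "\<lambda>j. j - 1"]) auto
      finally show ?thesis using True by (simp add: act_apply)
    next
      case False
      then show ?thesis by (simp add: act_outside)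
    qed
  qed
qed simp

lemma act_mult:
  assumes A: "A \<in> carrier_mat (n - 1) (n - 1)" and B: "B \<in> carrier_mat (n - 1) (n - 1)"
  shows "act n (A * B) x = act n A (act n B x)"
proof
  fix i
  show "act n (A * B) x i = act n A (act n B x) i"
  proof (cases "0 < i \<and> i < n")
    case True
    then have i: "i - 1 < n - 1" by auto
    have "act n (A * B) x i = (\<Sum>k<n - 1. (\<Sum>l<n - 1. A $$ (i - 1, l) * B $$ (l, k)) * x (Suc k))"
      using True i A B by (simp add: act_apply scalar_prod_def atLeast0LessThan)
    also have "\<dots> = (\<Sum>k<n - 1. \<Sum>l<n - 1. A $$ (i - 1, l) * (B $$ (l, k) * x (Suc k)))"
      by (simp add: sum_distrib_right mult.assoc)
    also have "\<dots> = (\<Sum>l<n - 1. \<Sum>k<n - 1. A $$ (i - 1, l) * (B $$ (l, k) * x (Suc k)))"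
      by (rule sum.swap)
    also have "\<dots> = (\<Sum>l<n - 1. A $$ (i - 1, l) * (\<Sum>k<n - 1. B $$ (l, k) * x (Suc k)))"
      by (simp add: sum_distrib_left)
    also have "\<dots> = (\<Sum>l<n - 1. A $$ (i - 1, l) * act n B x (Suc l))"
      by (rule sum.cong) (auto simp: act_apply)
    finally show ?thesis using True by (simp add: act_apply)
  qed (simp add: act_outside)
qed

lemma act_one: "x \<in> coord_space n \<Longrightarrow> act n (1\<^sub>m (n - 1)) x = x"
proof
  fix i assume x: "x \<in> coord_space n"
  show "act n (1\<^sub>m (n - 1)) x i = x i"
  proof (cases "0 < i \<and> i < n")
    case True
    then have i: "i - 1 < n - 1" by auto
    then have "(\<Sum>k<n - 1. 1\<^sub>m (n - 1) $$ (i - 1, k) * x (Suc k)) = (\<Sum>k<n - 1. if k = i - 1 then x i else 0)"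
      by (intro sum.cong) (use True in auto)
    also have "\<dots> = x i" using i by simp
    finally show ?thesis using True by (simp add: act_apply)
  next
    case False
    then have "i = 0 \<or> n \<le> i" by auto
    then have "x i = 0" using coord_space_0[OF x] coord_space_ge[OF x] by auto
    then show ?thesis using False by (simp add: act_outside)
  qed
qed

lemma act_smult:
  assumes "A \<in> carrier_mat (n - 1) (n - 1)"
  shows "act n (k \<cdot>\<^sub>m A) x i = k * act n A x i"
proof (cases "0 < i \<and> i < n")
  case True
  then have "i - 1 < n - 1" by auto
  then show ?thesis using assms True by (simp add: act_apply sum_distrib_left mult.assoc)
qed (simp add: act_outside)

lemma act_eqI:
  assumes A: "A \<in> carrier_mat (n - 1) (n - 1)" and B: "B \<in> carrier_mat (n - 1) (n - 1)"
    and eq: "\<And>x. x \<in> coord_space n \<Longrightarrow> act n A x = act n B x"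
  shows "A = B"
proof (rule eq_matI)
  show "dim_row A = dim_row B" "dim_col A = dim_col B" using A B by auto
  fix p q assume "p < dim_row B" "q < dim_col B"
  then have p: "Suc p < n" and q: "Suc q < n" using B by auto
  have "act n A (unit_coord (Suc q)) (Suc p) = act n B (unit_coord (Suc q)) (Suc p)"
    using eq[of "unit_coord (Suc q)"] q by simp
  then show "A $$ (p, q) = B $$ (p, q)" using p q by (simp add: act_unit_coord)
qed

section \<open>Matrices that change one coordinate\<close>

text \<open>Row \<open>i\<close> of the matrix of \<open>nbr_update a b c i\<close>.\<close>

definition nbr_coeff :: "complex \<Rightarrow> complex \<Rightarrow> complex \<Rightarrow> nat \<Rightarrow> nat \<Rightarrow> complex" where
  "nbr_coeff a b c i j = (if Suc j = i then a else if j = i then b else if j = Suc i then c else 0)"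

definition nbr_mat :: "nat \<Rightarrow> complex \<Rightarrow> complex \<Rightarrow> complex \<Rightarrow> nat \<Rightarrow> complex mat" where
  "nbr_mat n a b c i = mat (n - 1) (n - 1)
     (\<lambda>(p, q). if Suc p = i then nbr_coeff a b c i (Suc q) else if p = q then 1 else 0)"

lemma nbr_mat_carrier [simp]: "nbr_mat n a b c i \<in> carrier_mat (n - 1) (n - 1)"
  by (simp add: nbr_mat_def)

lemma nbr_update_apply:
  "nbr_update a b c i x p = (if p = i then a * x (i - 1) + b * x i + c * x (i + 1) else x p)"
  by (simp add: nbr_update_def)

lemma linear_op_eqI:
  assumes "linear_op n A" "linear_op n B" "x \<in> coord_space n"
    and "\<And>j. 1 \<le> j \<Longrightarrow> j < n \<Longrightarrow> A (unit_coord j) = B (unit_coord j)"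
  shows "A x = B x"
proof
  fix i
  show "A x i = B x i"
    unfolding linear_op_expand[OF assms(1,3)] linear_op_expand[OF assms(2,3)]
    by (rule sum.cong) (use assms(4) in auto)
qed

lemma sum_unit_coord:
  assumes "x \<in> coord_space n"
  shows "(\<Sum>j=1..<n. x j * unit_coord j i) = x i"
proof -
  have "(\<Sum>j=1..<n. x j * unit_coord j i) = (\<Sum>j=1..<n. if j = i then x i else 0)"
    by (rule sum.cong) (auto simp: unit_coord_apply)
  also have "\<dots> = (if i \<in> {1..<n} then x i else 0)" by simp
  also have "\<dots> = x i"
  proof (cases "i \<in> {1..<n}")
    case False
    then have "i = 0 \<or> n \<le> i" by auto
    then have "x i = 0" using coord_space_0[OF assms] coord_space_ge[OF assms] by auto
    then show ?thesis by simp
  qed simp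
  finally show ?thesis .
qed

lemma linear_op_nbr_update:
  assumes i: "1 \<le> i" "i < n"
  shows "linear_op n (nbr_update a b c i)"
  unfolding linear_op_def
proof (intro ballI conjI)
  fix x assume x: "x \<in> coord_space n"
  show "nbr_update a b c i x \<in> coord_space n" using x i by simp
  show "nbr_update a b c i x = (\<lambda>p. \<Sum>j=1..<n. x j * nbr_update a b c i (unit_coord j) p)"
  proof
    fix p
    show "nbr_update a b c i x p = (\<Sum>j=1..<n. x j * nbr_update a b c i (unit_coord j) p)"
    proof (cases "p = i")
      case True
      have "(\<Sum>j=1..<n. x j * (a * unit_coord j (i - 1) + b * unit_coord j i + c * unit_coord j (i + 1)))
          = a * (\<Sum>j=1..<n. x j * unit_coord j (i - 1)) + b * (\<Sum>j=1..<n. x j * unit_coord j i)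
            + c * (\<Sum>j=1..<n. x j * unit_coord j (i + 1))"
        by (simp only: distrib_left sum.distrib sum_distrib_left mult.left_commute)
      then show ?thesis unfolding sum_unit_coord[OF x] nbr_update_apply if_P[OF True] by simp
    next
      case False
      show ?thesis unfolding nbr_update_apply if_not_P[OF False] sum_unit_coord[OF x] ..
    qed
  qed
qed

lemma act_nbr_mat:
  assumes i: "1 \<le> i" "i < n" and x: "x \<in> coord_space n"
  shows "act n (nbr_mat n a b c i) x = nbr_update a b c i x"
proof (rule linear_op_eqI[OF linear_op_act linear_op_nbr_update[OF i] x])
  fix j assume j: "1 \<le> j" "j < n"
  show "act n (nbr_mat n a b c i) (unit_coord j) = nbr_update a b c i (unit_coord j)"
  proof
    fix p
    have "nbr_mat n a b c i $$ (p - 1, j - 1) = nbr_update a b c i (unit_coord j) p" if p: "0 < p" "p < n"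
    proof -
      obtain p' j' where "p = Suc p'" "j = Suc j'" using p j by (cases p; cases j) auto
      then show ?thesis using p j i
        by (auto simp: nbr_mat_def nbr_update_apply nbr_coeff_def unit_coord_apply)
    qed
    moreover have "nbr_update a b c i (unit_coord j) p = 0" if "\<not> (0 < p \<and> p < n)"
      using that coord_space_0[OF nbr_update_in[OF unit_coord_in[OF j] i]]
        coord_space_ge[OF nbr_update_in[OF unit_coord_in[OF j] i], of p] by (cases "p = 0") auto
    ultimately show "act n (nbr_mat n a b c i) (unit_coord j) p = nbr_update a b c i (unit_coord j) p"
      using j by (simp add: act_unit_coord)
  qed
qed

lemma act_transpose_nbr_mat:
  assumes i: "1 \<le> i" "i < n" and k: "1 \<le> k" "k < n"
  shows "act n (transpose_mat (nbr_mat n a b c i)) y k = y k + y i * nbr_coeff a (b - 1) c i k"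
proof -
  obtain m l where m: "i = Suc m" "k = Suc l" using i k by (cases i; cases k) auto
  then have ml: "m < n - 1" "l < n - 1" using i k by auto
  have "(\<Sum>p<n - 1. nbr_mat n a b c i $$ (p, l) * y (Suc p))
      = (\<Sum>p<n - 1. (if p = l then y k else 0) + (if p = m then y i * nbr_coeff a (b - 1) c i k else 0))"
    by (rule sum.cong) (use m ml in \<open>auto simp: nbr_mat_def nbr_coeff_def algebra_simps\<close>)
  also have "\<dots> = y k + y i * nbr_coeff a (b - 1) c i k"
    using ml by (simp add: sum.distrib)
  also have "(\<Sum>p<n - 1. nbr_mat n a b c i $$ (p, l) * y (Suc p))
      = (\<Sum>p<n - 1. transpose_mat (nbr_mat n a b c i) $$ (l, p) * y (Suc p))"
    by (rule sum.cong) (use ml in \<open>auto simp: nbr_mat_def\<close>)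
  finally show ?thesis using m k by (simp add: act_apply)
qed

lemma index_diag_block_mat_2:
  assumes "A \<in> carrier_mat r r" "B \<in> carrier_mat s s"
  shows "diag_block_mat [A, B] \<in> carrier_mat (r + s) (r + s)"
    and "p < r + s \<Longrightarrow> q < r + s \<Longrightarrow> diag_block_mat [A, B] $$ (p, q) =
      (if p < r then if q < r then A $$ (p, q) else 0
       else if q < r then 0 else B $$ (p - r, q - r))"
  using assms by (auto simp: Let_def)

lemma index_diag_block_mat_3:
  assumes "A \<in> carrier_mat r r" "B \<in> carrier_mat s s" "C \<in> carrier_mat t t"
  shows "diag_block_mat [A, B, C] \<in> carrier_mat (r + s + t) (r + s + t)"
    and "p < r + s + t \<Longrightarrow> q < r + s + t \<Longrightarrow> diag_block_mat [A, B, C] $$ (p, q) =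
      (if p < r then if q < r then A $$ (p, q) else 0
       else if p < r + s then if r \<le> q \<and> q < r + s then B $$ (p - r, q - r) else 0
       else if r + s \<le> q then C $$ (p - (r + s), q - (r + s)) else 0)"
  using assms by (auto simp: Let_def)

text \<open>The block matrices of the three shapes are compared with a candidate entry by entry, with the
  indices of the nontrivial block counted from \<open>0\<close>.\<close>

lemma local_mat_eqI:
  assumes n: "5 \<le> n" and i: "1 \<le> i" "i < n" and M: "M \<in> carrier_mat (n - 1) (n - 1)"
    and first: "\<And>p q. i = 1 \<Longrightarrow> p < n - 1 \<Longrightarrow> q < n - 1 \<Longrightarrow> M $$ (p, q) =
      (if p < 2 \<and> q < 2 then A ! p ! q else if p = q then 1 else 0)"
    and inner: "\<And>p q. 2 \<le> i \<Longrightarrow> i \<le> n - 2 \<Longrightarrow> p < n - 1 \<Longrightarrow> q < n - 1 \<Longrightarrow> M $$ (p, q) =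
      (if i - 2 \<le> p \<and> p \<le> i \<and> i - 2 \<le> q \<and> q \<le> i then B ! (p - (i - 2)) ! (q - (i - 2)) else if p = q then 1 else 0)"
    and final: "\<And>p q. i = n - 1 \<Longrightarrow> p < n - 1 \<Longrightarrow> q < n - 1 \<Longrightarrow> M $$ (p, q) =
      (if n - 3 \<le> p \<and> n - 3 \<le> q then C ! (p - (n - 3)) ! (q - (n - 3)) else if p = q then 1 else 0)"
    and dims: "length A = 2" "length B = 3" "length C = 2"
  shows "local_mat n A B C i = M"
proof -
  have A: "mat_of_rows_list 2 A \<in> carrier_mat 2 2" and C: "mat_of_rows_list 2 C \<in> carrier_mat 2 2"
    and B: "mat_of_rows_list 3 B \<in> carrier_mat 3 3"
    using dims by (auto simp: mat_of_rows_list_def)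
  consider "i = 1" | "i = n - 1" "i \<noteq> 1" | "2 \<le> i" "i \<le> n - 2" using i by linarith
  then show ?thesis
  proof cases
    case 1
    have *: "2 + (n - 3) = n - 1" using n by simp
    note D = index_diag_block_mat_2[OF A one_carrier_mat[of "n - 3"], unfolded *]
    show ?thesis unfolding local_mat_def if_P[OF 1]
    proof (rule eq_matI)
      show "dim_row (diag_block_mat [mat_of_rows_list 2 A, 1\<^sub>m (n - 3)]) = dim_row M"
        "dim_col (diag_block_mat [mat_of_rows_list 2 A, 1\<^sub>m (n - 3)]) = dim_col M"
        using D(1) M by (metis carrier_matD)+
      fix p q assume "p < dim_row M" "q < dim_col M"
      then have "p < n - 1" "q < n - 1" using M by auto
      then show "diag_block_mat [mat_of_rows_list 2 A, 1\<^sub>m (n - 3)] $$ (p, q) = M $$ (p, q)"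
        unfolding D(2)[OF \<open>p < n - 1\<close> \<open>q < n - 1\<close>] first[OF 1 \<open>p < n - 1\<close> \<open>q < n - 1\<close>]
        using dims by (auto simp: mat_of_rows_list_def)
    qed
  next
    case 2
    have *: "(n - 3) + 2 = n - 1" using n by simp
    note D = index_diag_block_mat_2[OF one_carrier_mat[of "n - 3"] C, unfolded *]
    show ?thesis unfolding local_mat_def if_not_P[OF 2(2)] if_P[OF 2(1)]
    proof (rule eq_matI)
      show "dim_row (diag_block_mat [1\<^sub>m (n - 3), mat_of_rows_list 2 C]) = dim_row M"
        "dim_col (diag_block_mat [1\<^sub>m (n - 3), mat_of_rows_list 2 C]) = dim_col M"
        using D(1) M by (metis carrier_matD)+
      fix p q assume "p < dim_row M" "q < dim_col M"
      then have "p < n - 1" "q < n - 1" using M by auto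
      then show "diag_block_mat [1\<^sub>m (n - 3), mat_of_rows_list 2 C] $$ (p, q) = M $$ (p, q)"
        unfolding D(2)[OF \<open>p < n - 1\<close> \<open>q < n - 1\<close>] final[OF 2(1) \<open>p < n - 1\<close> \<open>q < n - 1\<close>]
        using dims by (auto simp: mat_of_rows_list_def)
    qed
  next
    case 3
    have *: "(i - 2) + 3 = i + 1" "i + 1 + (n - i - 2) = n - 1" using n 3 by auto
    note D = index_diag_block_mat_3[OF one_carrier_mat[of "i - 2"] B one_carrier_mat[of "n - i - 2"], unfolded *]
    have ne: "i \<noteq> 1" "i \<noteq> n - 1" using 3 n by auto
    show ?thesis unfolding local_mat_def if_not_P[OF ne(1)] if_not_P[OF ne(2)]
    proof (rule eq_matI)
      show "dim_row (diag_block_mat [1\<^sub>m (i - 2), mat_of_rows_list 3 B, 1\<^sub>m (n - i - 2)]) = dim_row M"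
        "dim_col (diag_block_mat [1\<^sub>m (i - 2), mat_of_rows_list 3 B, 1\<^sub>m (n - i - 2)]) = dim_col M"
        using D(1) M by (metis carrier_matD)+
      fix p q assume "p < dim_row M" "q < dim_col M"
      then have pq: "p < n - 1" "q < n - 1" using M by auto
      show "diag_block_mat [1\<^sub>m (i - 2), mat_of_rows_list 3 B, 1\<^sub>m (n - i - 2)] $$ (p, q) = M $$ (p, q)"
        unfolding D(2)[OF pq] inner[OF 3 pq]
        using dims pq 3 by (auto simp: mat_of_rows_list_def)
    qed
  qed
qed

lemma nth_list2: "p < 2 \<Longrightarrow> [a, b] ! p = (if p = 0 then a else b)"
  by (cases p) auto

lemma nth_list3: "p < 3 \<Longrightarrow> [a, b, c] ! p = (if p = 0 then a else if p = 1 then b else c)"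
  by (cases p; cases "p - 1") auto

lemma local_mat_nbr_mat:
  assumes n: "5 \<le> n" and i: "1 \<le> i" "i < n"
  shows "local_mat n [[b, c], [0, 1]] [[1, 0, 0], [a, b, c], [0, 0, 1]] [[1, 0], [a, b]] i = nbr_mat n a b c i"
  by (rule local_mat_eqI[OF n i]) (use n i in \<open>auto simp: nbr_mat_def nbr_coeff_def nth_list2 nth_list3\<close>)

text \<open>The Burau matrices and the matrices with a hat act on columns through the transpose of a coordinate
  update; equivalently, they act on rows by the update itself.\<close>

lemma local_mat_transpose_nbr_mat:
  assumes n: "5 \<le> n" and i: "1 \<le> i" "i < n"
  shows "local_mat n [[b, 0], [c, 1]] [[1, a, 0], [0, b, 0], [0, c, 1]] [[1, a], [0, b]] i
           = transpose_mat (nbr_mat n a b c i)"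
  by (rule local_mat_eqI[OF n i]) (use n i in \<open>auto simp: nbr_mat_def nbr_coeff_def nth_list2 nth_list3\<close>)

section \<open>The defining relations on coordinate sequences\<close>

text \<open>One scalar \<open>s\<close> covers both families: \<open>s = 1\<close> gives the matrices with a tilde and \<open>s = z\<close> the
  transposes of those with a hat.\<close>

fun wb_op :: "complex \<Rightarrow> complex \<Rightarrow> wb_gen \<Rightarrow> (nat \<Rightarrow> complex) \<Rightarrow> nat \<Rightarrow> complex" where
  "wb_op s z (Sigma i) = nbr_update z (- z) 1 i"
| "wb_op s z (Alpha i) = nbr_update s (- 1) (1 / s) i"

lemma wb_relations_cases:
  assumes "(u, v) \<in> wb_relations n"
  obtains (invol) i where "1 \<le> i" "i < n" "u = [Alpha i, Alpha i]" "v = []"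
  | (far) i j x y where "1 \<le> i" "i < n" "1 \<le> j" "j < n" "i + 2 \<le> j \<or> j + 2 \<le> i"
      "u = [x, y]" "v = [y, x]" "x = Alpha i \<or> x = Sigma i" "y = Alpha j \<or> y = Sigma j"
  | (adjacent) i where "1 \<le> i" "i + 1 < n"
      "(u, v) \<in> {([Alpha i, Alpha (i + 1), Alpha i], [Alpha (i + 1), Alpha i, Alpha (i + 1)]),
         ([Sigma i, Sigma (i + 1), Sigma i], [Sigma (i + 1), Sigma i, Sigma (i + 1)]),
         ([Alpha i, Alpha (i + 1), Sigma i], [Sigma (i + 1), Alpha i, Alpha (i + 1)]),
         ([Sigma i, Sigma (i + 1), Alpha i], [Alpha (i + 1), Sigma i, Sigma (i + 1)])}"
  using assms unfolding wb_relations_def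
proof (elim UnE UN_E)
  fix i assume "i \<in> {1..n - 1}" "(u, v) \<in> {([Alpha i, Alpha i], [])}"
  then show thesis by (intro invol[of i]) auto
next
  fix i j assume "i \<in> {1..n - 1}" "j \<in> {j \<in> {1..n - 1}. \<bar>int i - int j\<bar> \<ge> 2}"
    "(u, v) \<in> {([Alpha i, Alpha j], [Alpha j, Alpha i]),
         ([Sigma i, Sigma j], [Sigma j, Sigma i]),
         ([Alpha i, Sigma j], [Sigma j, Alpha i])}"
  then show thesis by (intro far[of i j "hd u" "hd v"]) auto
next
  fix i assume "i \<in> {1..n - 2}"
    "(u, v) \<in> {([Alpha i, Alpha (i + 1), Alpha i], [Alpha (i + 1), Alpha i, Alpha (i + 1)]),
         ([Sigma i, Sigma (i + 1), Sigma i], [Sigma (i + 1), Sigma i, Sigma (i + 1)]),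
         ([Alpha i, Alpha (i + 1), Sigma i], [Sigma (i + 1), Alpha i, Alpha (i + 1)]),
         ([Sigma i, Sigma (i + 1), Alpha i], [Alpha (i + 1), Sigma i, Sigma (i + 1)])}"
  then show thesis by (intro adjacent[of i]) auto
qed

lemma wb_relations_gens:
  assumes "(u, v) \<in> wb_relations n"
  shows "set u \<subseteq> wb_gens n" "set v \<subseteq> wb_gens n"
  using assms by (cases rule: wb_relations_cases; auto simp: wb_gens_def)+

lemma nbr_update_commute:
  assumes "1 \<le> i" "1 \<le> j" "i + 2 \<le> j \<or> j + 2 \<le> i"
  shows "nbr_update a b c i (nbr_update a' b' c' j x) = nbr_update a' b' c' j (nbr_update a b c i x)"
proof -
  have "i \<noteq> j" "i - 1 \<noteq> j" "i + 1 \<noteq> j" "j - 1 \<noteq> i" "j + 1 \<noteq> i" using assms by auto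
  then show ?thesis by (simp add: fun_eq_iff nbr_update_apply)
qed

lemma nbr_update_involution:
  assumes "1 \<le> i" "s \<noteq> 0"
  shows "nbr_update s (- 1) (1 / s) i (nbr_update s (- 1) (1 / s) i x) = x"
proof -
  have "i - 1 \<noteq> i" "i + 1 \<noteq> i" using assms by auto
  then show ?thesis by (simp add: fun_eq_iff nbr_update_apply)
qed

lemma wb_op_far:
  assumes "1 \<le> i" "1 \<le> j" "i + 2 \<le> j \<or> j + 2 \<le> i"
    and "x = Alpha i \<or> x = Sigma i" "y = Alpha j \<or> y = Sigma j"
  shows "wb_op s z x (wb_op s z y w) = wb_op s z y (wb_op s z x w)"
  using assms(4,5) nbr_update_commute[OF assms(1-3)] by auto

lemma nbr_update_Suc:
  "nbr_update a b c (Suc m) x p = (if p = Suc m then a * x m + b * x (Suc m) + c * x (Suc (Suc m)) else x p)"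
  by (simp add: nbr_update_apply)

text \<open>For \<open>s = 1\<close> words act from the left. In terms of the differences \<open>d\<^sub>i = x\<^sub>i - x\<^sub>i\<^sub>-\<^sub>1\<close> the generator
  \<open>\<alpha>\<^sub>i\<close> swaps \<open>d\<^sub>i\<close> and \<open>d\<^sub>i\<^sub>+\<^sub>1\<close>, and \<open>\<sigma>\<^sub>i\<close> is the unreduced Burau generator.\<close>

lemma wb_relation_op_left:
  assumes "(u, v) \<in> wb_relations n"
  shows "foldr (wb_op 1 z) u x = foldr (wb_op 1 z) v x"
  using assms
proof (cases rule: wb_relations_cases)
  case (invol i)
  then show ?thesis using nbr_update_involution[of i 1 x] by simp
next
  case (far i j a b)
  then show ?thesis using wb_op_far[of i j a b 1 z x] by simp
next
  case (adjacent i)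
  then obtain m where m: "i = Suc m" by (cases i) auto
  show ?thesis using adjacent(3) unfolding m
    by (elim insertE) (simp_all add: fun_eq_iff nbr_update_Suc algebra_simps)
qed

text \<open>For \<open>s = z\<close> the same identities hold for reversed words, which is what transposition produces.\<close>

lemma wb_relation_op_right:
  assumes "(u, v) \<in> wb_relations n" "z \<noteq> 0"
  shows "fold (wb_op z z) u x = fold (wb_op z z) v x"
  using assms(1)
proof (cases rule: wb_relations_cases)
  case (invol i)
  then show ?thesis using nbr_update_involution[of i z x] assms(2) by simp
next
  case (far i j a b)
  then show ?thesis using wb_op_far[of i j a b z z x] by simp
next
  case (adjacent i)
  then obtain m where m: "i = Suc m" by (cases i) auto
  show ?thesis using adjacent(3) assms(2) unfolding m
    by (elim insertE) (simp_all add: fun_eq_iff nbr_update_Suc field_simps)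
qed

section \<open>The general linear group\<close>

(* Keeps indices 1 and dimensions n - 1 in the form in which the carrier lemmas state them. *)
declare One_nat_def [simp del]

lemma GL_simps [simp]:
  "A \<otimes>\<^bsub>GL m\<^esub> B = A * B" "\<one>\<^bsub>GL m\<^esub> = 1\<^sub>m m"
  by (simp_all add: GL_def units_of_def ring_mat_simps)

lemma GL_carrier_mat: "A \<in> carrier (GL m) \<Longrightarrow> A \<in> carrier_mat m m"
  by (simp add: GL_def units_of_def Units_def ring_mat_simps)

lemma GL_memI:
  "A \<in> carrier_mat m m \<Longrightarrow> B \<in> carrier_mat m m \<Longrightarrow> A * B = 1\<^sub>m m \<Longrightarrow> B * A = 1\<^sub>m m \<Longrightarrow> A \<in> carrier (GL m)"
  by (auto simp: GL_def units_of_def Units_def ring_mat_simps)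

lemma group_GL: "group (GL m)"
proof -
  interpret ring "ring_mat TYPE(complex) m ()" by (rule ring_mat)
  show ?thesis unfolding GL_def by (rule units_group)
qed

lemma GL_inv:
  assumes "A \<in> carrier (GL m)"
  shows "inv\<^bsub>GL m\<^esub> A \<in> carrier (GL m)" "A * inv\<^bsub>GL m\<^esub> A = 1\<^sub>m m" "inv\<^bsub>GL m\<^esub> A * A = 1\<^sub>m m"
proof -
  interpret group "GL m" by (rule group_GL)
  show "inv\<^bsub>GL m\<^esub> A \<in> carrier (GL m)" using assms by simp
  show "A * inv\<^bsub>GL m\<^esub> A = 1\<^sub>m m" using r_inv[OF assms] by simp
  show "inv\<^bsub>GL m\<^esub> A * A = 1\<^sub>m m" using l_inv[OF assms] by simp
qed

lemma GL_transpose: "A \<in> carrier (GL m) \<Longrightarrow> transpose_mat A \<in> carrier (GL m)"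
proof -
  assume A: "A \<in> carrier (GL m)"
  let ?B = "inv\<^bsub>GL m\<^esub> A"
  have c: "A \<in> carrier_mat m m" "?B \<in> carrier_mat m m" using A GL_inv(1)[OF A] GL_carrier_mat by auto
  have "transpose_mat A * transpose_mat ?B = 1\<^sub>m m" "transpose_mat ?B * transpose_mat A = 1\<^sub>m m"
    unfolding transpose_mult[OF c, symmetric] transpose_mult[OF c(2,1), symmetric]
    by (simp_all add: GL_inv(2,3)[OF A])
  then show ?thesis using c by (intro GL_memI[of _ _ "transpose_mat ?B"]) auto
qed

lemma GL_smult:
  assumes A: "A \<in> carrier (GL m)" and k: "k \<noteq> 0"
  shows "k \<cdot>\<^sub>m A \<in> carrier (GL m)"
proof -
  let ?B = "inv\<^bsub>GL m\<^esub> A"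
  have c: "A \<in> carrier_mat m m" "?B \<in> carrier_mat m m" using A GL_inv(1)[OF A] GL_carrier_mat by auto
  have "(k \<cdot>\<^sub>m A) * (inverse k \<cdot>\<^sub>m ?B) = (k * inverse k) \<cdot>\<^sub>m (A * ?B)"
    "(inverse k \<cdot>\<^sub>m ?B) * (k \<cdot>\<^sub>m A) = (k * inverse k) \<cdot>\<^sub>m (?B * A)"
    using c by (auto intro!: eq_matI simp: mult.assoc mult.left_commute mult.commute)
  then have "(k \<cdot>\<^sub>m A) * (inverse k \<cdot>\<^sub>m ?B) = 1\<^sub>m m" "(inverse k \<cdot>\<^sub>m ?B) * (k \<cdot>\<^sub>m A) = 1\<^sub>m m"
    using GL_inv(2,3)[OF A] k by auto
  then show ?thesis using c by (intro GL_memI[of _ _ "inverse k \<cdot>\<^sub>m ?B"]) auto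
qed

lemma nbr_update_inverse:
  assumes "1 \<le> i" "b \<noteq> 0"
  shows "nbr_update a b c i (nbr_update (- a / b) (1 / b) (- c / b) i x) = x"
    and "nbr_update (- a / b) (1 / b) (- c / b) i (nbr_update a b c i x) = x"
proof -
  have "i - 1 \<noteq> i" "i + 1 \<noteq> i" using assms by auto
  then show "nbr_update a b c i (nbr_update (- a / b) (1 / b) (- c / b) i x) = x"
    "nbr_update (- a / b) (1 / b) (- c / b) i (nbr_update a b c i x) = x"
    using assms by (simp_all add: fun_eq_iff nbr_update_apply field_simps)
qed

lemma nbr_mat_in_GL:
  assumes i: "1 \<le> i" "i < n" and b: "b \<noteq> 0"
  shows "nbr_mat n a b c i \<in> carrier (GL (n - 1))"
proof (rule GL_memI)
  let ?A = "nbr_mat n a b c i" and ?B = "nbr_mat n (- a / b) (1 / b) (- c / b) i"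
  show "?A * ?B = 1\<^sub>m (n - 1)"
    by (rule act_eqI[of _ n]) (simp_all add: act_mult mult_carrier_mat[OF nbr_mat_carrier nbr_mat_carrier] act_nbr_mat[OF i] act_one i nbr_update_inverse(1)[OF i(1) b] del: divide_minus_left)
  show "?B * ?A = 1\<^sub>m (n - 1)"
    by (rule act_eqI[of _ n]) (simp_all add: act_mult mult_carrier_mat[OF nbr_mat_carrier nbr_mat_carrier] act_nbr_mat[OF i] act_one i nbr_update_inverse(2)[OF i(1) b] del: divide_minus_left)
qed (rule nbr_mat_carrier)+

lemma act_eval_list:
  assumes f: "\<And>g. g \<in> set xs \<Longrightarrow> f g \<in> carrier (GL (n - 1))"
    and x: "x \<in> coord_space n"
  shows "act n (eval_list (GL (n - 1)) f xs) x = foldr (\<lambda>g. act n (f g)) xs x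
     \<and> eval_list (GL (n - 1)) f xs \<in> carrier (GL (n - 1))"
proof -
  interpret group "GL (n - 1)" by (rule group_GL)
  show ?thesis using f
  proof (induction xs)
    case Nil
    then show ?case using x one_closed by (simp add: act_one)
  next
    case (Cons g xs)
    then have "f g \<in> carrier (GL (n - 1))" "eval_list (GL (n - 1)) f xs \<in> carrier (GL (n - 1))" by auto
    then show ?case using Cons m_closed[of "f g"] by (simp add: act_mult GL_carrier_mat)
  qed
qed

lemma act_transpose_eval_list:
  assumes f: "\<And>g. g \<in> set xs \<Longrightarrow> f g \<in> carrier (GL (n - 1))"
    and x: "x \<in> coord_space n"
  shows "act n (transpose_mat (eval_list (GL (n - 1)) f xs)) x = fold (\<lambda>g. act n (transpose_mat (f g))) xs x
     \<and> eval_list (GL (n - 1)) f xs \<in> carrier (GL (n - 1))"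
proof -
  interpret group "GL (n - 1)" by (rule group_GL)
  show ?thesis using f x
  proof (induction xs arbitrary: x)
    case Nil
    then show ?case using one_closed by (simp add: act_one)
  next
    case (Cons g xs)
    then have g: "f g \<in> carrier (GL (n - 1))" and e: "eval_list (GL (n - 1)) f xs \<in> carrier (GL (n - 1))" by auto
    have "transpose_mat (f g * eval_list (GL (n - 1)) f xs)
        = transpose_mat (eval_list (GL (n - 1)) f xs) * transpose_mat (f g)"
      by (rule transpose_mult[OF GL_carrier_mat[OF g] GL_carrier_mat[OF e]])
    then show ?case using Cons m_closed[OF g e] by (simp add: act_mult GL_carrier_mat[OF g] GL_carrier_mat[OF e])
  qed
qed

lemma foldr_cong_on:
  assumes "\<And>g y. g \<in> set xs \<Longrightarrow> y \<in> V \<Longrightarrow> f g y = h g y \<and> h g y \<in> V" "x \<in> V"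
  shows "foldr f xs x = foldr h xs x \<and> foldr h xs x \<in> V"
  using assms(1) by (induction xs) (auto simp: assms(2))

lemma fold_cong_on:
  assumes "\<And>g y. g \<in> set xs \<Longrightarrow> y \<in> V \<Longrightarrow> f g y = h g y \<and> h g y \<in> V" "x \<in> V"
  shows "fold f xs x = fold h xs x"
  using assms by (induction xs arbitrary: x) auto

text \<open>The common parametrization of the two families of generator matrices, matching \<open>wb_op\<close>.\<close>

definition wb_mat :: "nat \<Rightarrow> complex \<Rightarrow> complex \<Rightarrow> wb_gen \<Rightarrow> complex mat" where
  "wb_mat n s z g = (case g of Sigma i \<Rightarrow> nbr_mat n z (- z) 1 i | Alpha i \<Rightarrow> nbr_mat n s (- 1) (1 / s) i)"

lemma wb_mat_in_GL: "g \<in> wb_gens n \<Longrightarrow> z \<noteq> 0 \<Longrightarrow> wb_mat n s z g \<in> carrier (GL (n - 1))"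
  by (cases g) (auto simp: wb_gens_def wb_mat_def intro!: nbr_mat_in_GL)

lemma act_wb_mat:
  assumes "g \<in> wb_gens n" "x \<in> coord_space n"
  shows "act n (wb_mat n s z g) x = wb_op s z g x \<and> wb_op s z g x \<in> coord_space n"
  using assms by (auto simp: wb_gens_def wb_mat_def act_nbr_mat)

lemma wb_mat_relations:
  assumes z: "z \<noteq> 0" and f: "\<And>g. g \<in> wb_gens n \<Longrightarrow> f g = wb_mat n 1 z g" and uv: "(u, v) \<in> wb_relations n"
  shows "eval_list (GL (n - 1)) f u = eval_list (GL (n - 1)) f v"
proof -
  have ev: "act n (eval_list (GL (n - 1)) f w) x = foldr (wb_op 1 z) w x" "eval_list (GL (n - 1)) f w \<in> carrier (GL (n - 1))"
    if w: "set w \<subseteq> wb_gens n" and x: "x \<in> coord_space n" for w x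
  proof -
    have "f g \<in> carrier (GL (n - 1))" if "g \<in> set w" for g
      using that w f wb_mat_in_GL[OF _ z] by (metis subsetD)
    note * = act_eval_list[of w f n x, OF this x]
    have "foldr (\<lambda>g. act n (f g)) w x = foldr (wb_op 1 z) w x"
      by (rule foldr_cong_on[THEN conjunct1, OF _ x]) (use act_wb_mat f w in auto)
    then show "act n (eval_list (GL (n - 1)) f w) x = foldr (wb_op 1 z) w x"
      "eval_list (GL (n - 1)) f w \<in> carrier (GL (n - 1))" using * by auto
  qed
  have zero: "(\<lambda>i. 0) \<in> coord_space n" by (rule coord_spaceI) auto
  show ?thesis
  proof (rule act_eqI)
    show "eval_list (GL (n - 1)) f u \<in> carrier_mat (n - 1) (n - 1)" "eval_list (GL (n - 1)) f v \<in> carrier_mat (n - 1) (n - 1)"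
      using ev(2) zero wb_relations_gens[OF uv] GL_carrier_mat by blast+
    fix x assume "x \<in> coord_space n"
    then show "act n (eval_list (GL (n - 1)) f u) x = act n (eval_list (GL (n - 1)) f v) x"
      using ev(1) wb_relations_gens[OF uv] wb_relation_op_left[OF uv] by metis
  qed
qed

lemma wb_mat_transpose_relations:
  assumes z: "z \<noteq> 0" and f: "\<And>g. g \<in> wb_gens n \<Longrightarrow> f g = transpose_mat (wb_mat n z z g)" and uv: "(u, v) \<in> wb_relations n"
  shows "eval_list (GL (n - 1)) f u = eval_list (GL (n - 1)) f v"
proof -
  have ev: "act n (transpose_mat (eval_list (GL (n - 1)) f w)) x = fold (wb_op z z) w x" "eval_list (GL (n - 1)) f w \<in> carrier (GL (n - 1))"
    if w: "set w \<subseteq> wb_gens n" and x: "x \<in> coord_space n" for w x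
  proof -
    have "f g \<in> carrier (GL (n - 1))" if "g \<in> set w" for g
      using that w f wb_mat_in_GL[OF _ z] GL_transpose by (metis subsetD)
    note * = act_transpose_eval_list[of w f n x, OF this x]
    have "fold (\<lambda>g. act n (transpose_mat (f g))) w x = fold (wb_op z z) w x"
      by (rule fold_cong_on[OF _ x]) (use act_wb_mat f w in auto)
    then show "act n (transpose_mat (eval_list (GL (n - 1)) f w)) x = fold (wb_op z z) w x"
      "eval_list (GL (n - 1)) f w \<in> carrier (GL (n - 1))" using * by auto
  qed
  have zero: "(\<lambda>i. 0) \<in> coord_space n" by (rule coord_spaceI) auto
  have c: "eval_list (GL (n - 1)) f u \<in> carrier_mat (n - 1) (n - 1)" "eval_list (GL (n - 1)) f v \<in> carrier_mat (n - 1) (n - 1)"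
    using ev(2) zero wb_relations_gens[OF uv] GL_carrier_mat by blast+
  have "transpose_mat (eval_list (GL (n - 1)) f u) = transpose_mat (eval_list (GL (n - 1)) f v)"
  proof (rule act_eqI)
    fix x assume "x \<in> coord_space n"
    then show "act n (transpose_mat (eval_list (GL (n - 1)) f u)) x = act n (transpose_mat (eval_list (GL (n - 1)) f v)) x"
      using ev(1) wb_relations_gens[OF uv] wb_relation_op_right[OF uv z] by metis
  qed (use c in auto)
  then show ?thesis by (metis transpose_transpose)
qed

section \<open>The representations\<close>

lemma burau_tilde_rep:
  assumes n: "5 \<le> n" and z: "z \<noteq> 0"
  shows "burau_tilde n z \<in> hom (welded_braid_group n) (GL (n - 1))"
    and "g \<in> wb_gens n \<Longrightarrow> burau_tilde n z (wb_elem n g) = wb_mat n 1 z g"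
proof -
  let ?f = "\<lambda>x. case x of Sigma i \<Rightarrow> burau_tilde_sigma n z i | Alpha i \<Rightarrow> burau_tilde_alpha n i"
  have f: "?f g = wb_mat n 1 z g" if "g \<in> wb_gens n" for g
    using that local_mat_nbr_mat[OF n]
    by (auto simp: wb_gens_def wb_mat_def burau_tilde_sigma_def burau_tilde_alpha_def)
  then have "?f \<in> wb_gens n \<rightarrow> carrier (GL (n - 1))" using wb_mat_in_GL[OF _ z] by auto
  note * = welded_braid_hom_on_gens[OF group_GL this wb_mat_relations[OF z f]]
  show "burau_tilde n z \<in> hom (welded_braid_group n) (GL (n - 1))" unfolding burau_tilde_def by (rule *(1))
  show "g \<in> wb_gens n \<Longrightarrow> burau_tilde n z (wb_elem n g) = wb_mat n 1 z g"
    using *(2) f unfolding burau_tilde_def by simp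
qed

lemma burau_hat_rep:
  assumes n: "5 \<le> n" and z: "z \<noteq> 0"
  shows "burau_hat n z \<in> hom (welded_braid_group n) (GL (n - 1))"
    and "g \<in> wb_gens n \<Longrightarrow> burau_hat n z (wb_elem n g) = transpose_mat (wb_mat n z z g)"
proof -
  let ?f = "\<lambda>x. case x of Sigma i \<Rightarrow> burau_sigma n z i | Alpha i \<Rightarrow> burau_hat_alpha n z i"
  have f: "?f g = transpose_mat (wb_mat n z z g)" if "g \<in> wb_gens n" for g
    using that local_mat_transpose_nbr_mat[OF n]
    by (auto simp: wb_gens_def wb_mat_def burau_sigma_def burau_hat_alpha_def)
  then have "?f \<in> wb_gens n \<rightarrow> carrier (GL (n - 1))" using wb_mat_in_GL[OF _ z] GL_transpose by auto
  note * = welded_braid_hom_on_gens[OF group_GL this wb_mat_transpose_relations[OF z f]]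
  show "burau_hat n z \<in> hom (welded_braid_group n) (GL (n - 1))" unfolding burau_hat_def by (rule *(1))
  show "g \<in> wb_gens n \<Longrightarrow> burau_hat n z (wb_elem n g) = transpose_mat (wb_mat n z z g)"
    using *(2) f unfolding burau_hat_def by simp
qed

lemma group_nonzero_complex: "group nonzero_complex"
proof (rule groupI)
  fix x assume "x \<in> carrier nonzero_complex"
  then show "\<exists>y\<in>carrier nonzero_complex. y \<otimes>\<^bsub>nonzero_complex\<^esub> x = \<one>\<^bsub>nonzero_complex\<^esub>"
    by (intro bexI[of _ "inverse x"]) (auto simp: nonzero_complex_def)
qed (auto simp: nonzero_complex_def)

lemma X_rep_character:
  assumes k: "k = 1 \<or> k = - 1"
  shows "X_rep n 1 k \<in> hom (welded_braid_group n) nonzero_complex"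
    and "g \<in> wb_gens n \<Longrightarrow> X_rep n 1 k (wb_elem n g) = (case g of Sigma i \<Rightarrow> 1 | Alpha i \<Rightarrow> k)"
proof -
  let ?f = "\<lambda>x. case x of Sigma i \<Rightarrow> (1::complex) | Alpha i \<Rightarrow> k"
  have f: "?f \<in> wb_gens n \<rightarrow> carrier nonzero_complex" using k by (auto simp: nonzero_complex_def wb_gens_def)
  have R: "eval_list nonzero_complex ?f u = eval_list nonzero_complex ?f v" if "(u, v) \<in> wb_relations n" for u v
    using that
  proof (cases rule: wb_relations_cases)
    case (adjacent i)
    then show ?thesis using k by (elim insertE) (auto simp: nonzero_complex_def)
  qed (use k in \<open>auto simp: nonzero_complex_def\<close>)
  note * = welded_braid_hom_on_gens[OF group_nonzero_complex f R]
  show "X_rep n 1 k \<in> hom (welded_braid_group n) nonzero_complex" unfolding X_rep_def by (rule *(1))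
  show "g \<in> wb_gens n \<Longrightarrow> X_rep n 1 k (wb_elem n g) = ?f g" unfolding X_rep_def by (rule *(2))
qed

lemma char_tensor_hom:
  assumes G: "group G" and chi: "\<chi> \<in> hom G nonzero_complex" and rho: "\<rho> \<in> hom G (GL m)"
  shows "char_tensor G \<chi> \<rho> \<in> hom G (GL m)"
proof (rule homI)
  interpret group G by (rule G)
  have nz: "\<chi> g \<noteq> 0" if "g \<in> carrier G" for g
    using hom_in_carrier[OF chi that] by (simp add: nonzero_complex_def)
  have mem: "\<rho> g \<in> carrier (GL m)" if "g \<in> carrier G" for g using hom_in_carrier[OF rho that] .
  fix g assume g: "g \<in> carrier G"
  show "char_tensor G \<chi> \<rho> g \<in> carrier (GL m)"
    using GL_smult[OF mem nz] g by (simp add: char_tensor_def)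
  fix h assume h: "h \<in> carrier G"
  have c: "\<rho> g \<in> carrier_mat m m" "\<rho> h \<in> carrier_mat m m" using mem g h GL_carrier_mat by auto
  have "(\<chi> g * \<chi> h) \<cdot>\<^sub>m (\<rho> g * \<rho> h) = (\<chi> g \<cdot>\<^sub>m \<rho> g) * (\<chi> h \<cdot>\<^sub>m \<rho> h)"
    using c by (auto intro!: eq_matI simp: mult.assoc mult.left_commute mult.commute)
  then show "char_tensor G \<chi> \<rho> (g \<otimes>\<^bsub>G\<^esub> h) = char_tensor G \<chi> \<rho> g \<otimes>\<^bsub>GL m\<^esub> char_tensor G \<chi> \<rho> h"
    using g h hom_mult[OF chi g h] hom_mult[OF rho g h]
    by (simp add: char_tensor_def nonzero_complex_def)
qed

text \<open>The homomorphism with a hat restricts to one with the values that define \<open>burau\<close>, so the latter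
  exists without any presentation of the braid subgroup.\<close>

lemma burau_value:
  assumes n: "5 \<le> n" and z: "z \<noteq> 0" and i: "1 \<le> i" "i < n"
  shows "burau n z (wb_elem n (Sigma i)) = transpose_mat (nbr_mat n z (- z) 1 i)"
    and "wb_elem n (Sigma i) \<in> carrier (braid_subgroup n)"
proof -
  let ?G = "welded_braid_group n" and ?S = "(\<lambda>i. wb_elem n (Sigma i)) ` {1..n - 1}"
  interpret G: group ?G by (rule group_welded_braid)
  have S: "?S \<subseteq> carrier ?G" using wb_elem_in by (auto simp: wb_gens_def)
  have B: "group (braid_subgroup n)" unfolding braid_subgroup_def by simp
  have SB: "?S \<subseteq> carrier (braid_subgroup n)"
    unfolding braid_subgroup_def by (rule G.subgroup_generated_subset_carrier_subset[OF S])
  have gen: "generate (braid_subgroup n) ?S = carrier (braid_subgroup n)"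
    using carrier_subgroup_generated[of "braid_subgroup n" ?S] SB G.subgroup_generated2[of ?S]
    unfolding braid_subgroup_def by (simp add: Int_absorb1)
  have h: "burau_hat n z \<in> hom (braid_subgroup n) (GL (n - 1))"
    unfolding braid_subgroup_def by (rule G.hom_from_subgroup_generated[OF burau_hat_rep(1)[OF n z]])
  have val: "burau_hat n z (wb_elem n (Sigma j)) = burau_sigma n z j" if "j \<in> {1..n - 1}" for j
    using that burau_hat_rep(2)[OF n z, of "Sigma j"] local_mat_transpose_nbr_mat[OF n, of j]
    by (auto simp: wb_gens_def wb_mat_def burau_sigma_def)
  have "burau n z (wb_elem n (Sigma i)) = burau_sigma n z i"
    unfolding burau_def
    by (rule hom_on_gens_characterization(2)[OF B group_GL h val SB gen]) (use i in auto)
  then show "burau n z (wb_elem n (Sigma i)) = transpose_mat (nbr_mat n z (- z) 1 i)"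
    using local_mat_transpose_nbr_mat[OF n i] by (simp add: burau_sigma_def)
  show "wb_elem n (Sigma i) \<in> carrier (braid_subgroup n)" using SB i by auto
qed

section \<open>The Gram matrix of the Burau forms\<close>

text \<open>The matrix \<open>z\<^sup>-\<^sup>i f\<^sub>i(e\<^sub>j)\<close>. The weights make it symmetric, since \<open>f\<^sub>i(e\<^sub>i\<^sub>+\<^sub>1) = 1\<close> and
  \<open>f\<^sub>i\<^sub>+\<^sub>1(e\<^sub>i) = z\<close>.\<close>

definition burau_gram :: "nat \<Rightarrow> complex \<Rightarrow> complex mat" where
  "burau_gram n z = mat (n - 1) (n - 1)
     (\<lambda>(p, q). inverse z ^ Suc p * burau_form z (Suc p) (unit_coord (Suc q)))"

lemma burau_gram_carrier [simp]: "burau_gram n z \<in> carrier_mat (n - 1) (n - 1)"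
  by (simp add: burau_gram_def)

lemma burau_form_comb:
  "burau_form z k (\<lambda>i. a * x i + b * y i) = a * burau_form z k x + b * burau_form z k y"
  by (simp add: burau_form_def algebra_simps)

lemma burau_form_expand:
  assumes x: "x \<in> coord_space n"
  shows "burau_form z i x = (\<Sum>j=1..<n. x j * burau_form z i (unit_coord j))"
proof -
  have "(\<Sum>j=1..<n. x j * burau_form z i (unit_coord j))
      = z * (\<Sum>j=1..<n. x j * unit_coord j (i - 1)) - (1 + z) * (\<Sum>j=1..<n. x j * unit_coord j i)
        + (\<Sum>j=1..<n. x j * unit_coord j (i + 1))"
    unfolding burau_form_def
    by (simp only: right_diff_distrib distrib_left sum.distrib sum_subtractf sum_distrib_left mult.left_commute)
  then show ?thesis unfolding sum_unit_coord[OF x] by (simp add: burau_form_def)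
qed

lemma act_burau_gram:
  assumes x: "x \<in> coord_space n" and i: "0 < i" "i < n"
  shows "act n (burau_gram n z) x i = inverse z ^ i * burau_form z i x"
proof -
  have i': "i - 1 < n - 1" "Suc (i - 1) = i" using i by auto
  have "act n (burau_gram n z) x i = (\<Sum>k<n - 1. inverse z ^ i * (x (Suc k) * burau_form z i (unit_coord (Suc k))))"
    unfolding act_apply[OF i]
    by (rule sum.cong) (use i' in \<open>auto simp: burau_gram_def simp del: power_Suc\<close>)
  also have "\<dots> = (\<Sum>j=1..<n. inverse z ^ i * (x j * burau_form z i (unit_coord j)))"
    by (rule sum.reindex_bij_witness[of _ "\<lambda>j. j - 1" Suc]) auto
  also have "\<dots> = inverse z ^ i * burau_form z i x"
    unfolding burau_form_expand[OF x] sum_distrib_left ..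
  finally show ?thesis .
qed

lemma burau_gram_symmetric:
  assumes z: "z \<noteq> 0"
  shows "transpose_mat (burau_gram n z) = burau_gram n z"
proof (rule eq_matI)
  fix p q assume "p < dim_row (burau_gram n z)" "q < dim_col (burau_gram n z)"
  then have "p < n - 1" "q < n - 1" by (auto simp: burau_gram_def)
  moreover have "inverse z ^ Suc q * burau_form z (Suc q) (unit_coord (Suc p))
      = inverse z ^ Suc p * burau_form z (Suc p) (unit_coord (Suc q))"
    using z by (auto simp: burau_form_unit)
  ultimately show "transpose_mat (burau_gram n z) $$ (p, q) = burau_gram n z $$ (p, q)"
    by (simp add: burau_gram_def)
qed (auto simp: burau_gram_def)

text \<open>A common zero of all \<open>f\<^sub>j\<close> is \<open>x\<^sub>j = x\<^sub>1 (1 + z + \<dots> + z\<^sup>j\<^sup>-\<^sup>1)\<close>, and \<open>x\<^sub>n = 0\<close> kills it. This is where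
  the hypothesis \<open>P\<^sub>n(z) \<noteq> 0\<close> enters.\<close>

lemma burau_forms_separate:
  assumes x: "x \<in> coord_space n" and n: "2 \<le> n"
    and f: "\<And>j. 0 < j \<Longrightarrow> j < n \<Longrightarrow> burau_form z j x = 0"
    and P: "(\<Sum>i<n. z ^ i) \<noteq> 0"
  shows "x i = 0"
proof -
  define S where "S j = (\<Sum>k<j. z ^ k)" for j :: nat
  have S: "S (Suc j) = S j + z ^ j" for j by (simp add: S_def)
  have geo: "Suc j \<le> n \<Longrightarrow> x j = x 1 * S j \<and> x (Suc j) = x 1 * S (Suc j)" for j
  proof (induction j)
    case 0
    then show ?case using x by (simp add: S_def One_nat_def)
  next
    case (Suc j)
    then have IH: "x j = x 1 * S j" "x (Suc j) = x 1 * S (Suc j)" by auto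
    have "burau_form z (Suc j) x = 0" using f Suc.prems by simp
    moreover have "burau_form z (Suc j) x = z * x j - (1 + z) * x (Suc j) + x (Suc (Suc j))"
      by (simp add: burau_form_def flip: Suc_eq_plus1)
    ultimately have "x (Suc (Suc j)) = (1 + z) * x (Suc j) - z * x j"
      by (simp add: algebra_simps)
    then have "x (Suc (Suc j)) = x 1 * S (Suc (Suc j))"
      unfolding IH S by (simp add: algebra_simps)
    with IH show ?case by simp
  qed
  have "x n = x 1 * S n" using geo[of "n - 1"] n by simp
  then have x1: "x 1 = 0" using P coord_space_ge[OF x order_refl] by (simp add: S_def)
  show ?thesis
  proof (cases "Suc i \<le> n")
    case True
    then show ?thesis using geo[of i] x1 by simp
  next
    case False
    then show ?thesis using coord_space_ge[OF x] by simp
  qed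
qed

lemma burau_gram_in_GL:
  assumes z: "z \<noteq> 0" and n: "2 \<le> n" and P: "(\<Sum>i<n. z ^ i) \<noteq> 0"
  shows "burau_gram n z \<in> carrier (GL (n - 1))"
proof -
  have "det (burau_gram n z) \<noteq> 0"
  proof
    assume "det (burau_gram n z) = 0"
    then obtain v where v: "v \<in> carrier_vec (n - 1)" "v \<noteq> 0\<^sub>v (n - 1)"
      and zero: "burau_gram n z *\<^sub>v v = 0\<^sub>v (n - 1)"
      using det_0_iff_vec_prod_zero_field[OF burau_gram_carrier] by blast
    define x where "x i = (if 0 < i \<and> i < n then v $ (i - 1) else 0)" for i
    have x: "x \<in> coord_space n" by (rule coord_spaceI) (auto simp: x_def)
    have "burau_form z j x = 0" if j: "0 < j" "j < n" for j
    proof -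
      have "(burau_gram n z *\<^sub>v v) $ (j - 1) = (\<Sum>k<n - 1. burau_gram n z $$ (j - 1, k) * v $ k)"
        using v(1) j by (simp add: burau_gram_def scalar_prod_def atLeast0LessThan)
      also have "\<dots> = (\<Sum>k<n - 1. burau_gram n z $$ (j - 1, k) * x (Suc k))"
        by (rule sum.cong) (auto simp: x_def)
      also have "\<dots> = inverse z ^ j * burau_form z j x"
        unfolding act_burau_gram[OF x j, symmetric] act_apply[OF j] ..
      finally show ?thesis using zero z j by simp
    qed
    then have x0: "x i = 0" for i using burau_forms_separate[OF x n _ P] by blast
    then have "v $ i = 0" if "i < n - 1" for i
    proof -
      have "0 < Suc i" "Suc i < n" using that by auto
      then have "x (Suc i) = v $ i" by (simp add: x_def)
      then show ?thesis using x0 by simp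
    qed
    then have "v = 0\<^sub>v (n - 1)" using v(1) by (intro eq_vecI) auto
    with v(2) show False ..
  qed
  then show ?thesis
    using det_non_zero_imp_unit[OF burau_gram_carrier, of n z "()"] by (simp add: GL_def units_of_def)
qed

text \<open>Both sides add to \<open>Q x\<close> a multiple of \<open>f\<^sub>i(x)\<close>, where \<open>Q\<close> is the Gram matrix, and the multiples agree
  by symmetry of \<open>Q\<close>.\<close>

lemma burau_gram_intertwines_sigma:
  assumes z: "z \<noteq> 0" and i: "1 \<le> i" "i < n"
  shows "transpose_mat (nbr_mat n z (- z) 1 i) * burau_gram n z = burau_gram n z * nbr_mat n z (- z) 1 i"
proof (rule act_eqI)
  fix x assume x: "x \<in> coord_space n"
  have t: "transpose_mat (nbr_mat n z (- z) 1 i) \<in> carrier_mat (n - 1) (n - 1)" by simp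
  show "act n (transpose_mat (nbr_mat n z (- z) 1 i) * burau_gram n z) x = act n (burau_gram n z * nbr_mat n z (- z) 1 i) x"
    unfolding act_mult[OF t burau_gram_carrier] act_mult[OF burau_gram_carrier nbr_mat_carrier] act_nbr_mat[OF i x]
  proof
    fix k
    show "act n (transpose_mat (nbr_mat n z (- z) 1 i)) (act n (burau_gram n z) x) k = act n (burau_gram n z) (burau_step z i x) k"
    proof (cases "0 < k \<and> k < n")
      case True
      then have k: "1 \<le> k" "k < n" "0 < k" and i0: "0 < i" using i by auto
      have coef: "inverse z ^ i * nbr_coeff z (- z - 1) 1 i k = inverse z ^ k * burau_form z k (unit_coord i)"
        using z k by (auto simp: nbr_coeff_def burau_form_unit)
      have step: "burau_form z k (burau_step z i x)
          = burau_form z k x + burau_form z i x * burau_form z k (unit_coord i)"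
        using burau_form_comb[of z k 1 x "burau_form z i x" "unit_coord i"] by (simp add: burau_step_form)
      have "act n (burau_gram n z) (burau_step z i x) k = inverse z ^ k * burau_form z k x
          + burau_form z i x * (inverse z ^ k * burau_form z k (unit_coord i))"
        unfolding act_burau_gram[OF nbr_update_in[OF x i] k(3,2)] step by (simp add: algebra_simps)
      also have "\<dots> = inverse z ^ k * burau_form z k x
          + inverse z ^ i * burau_form z i x * nbr_coeff z (- z - 1) 1 i k"
        unfolding coef[symmetric] by simp
      also have "\<dots> = act n (transpose_mat (nbr_mat n z (- z) 1 i)) (act n (burau_gram n z) x) k"
        unfolding act_transpose_nbr_mat[OF i k(1,2)] act_burau_gram[OF x k(3,2)] act_burau_gram[OF x i0 i(2)] ..
      finally show ?thesis ..
    qed (simp add: act_outside)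
  qed
qed (auto intro!: mult_carrier_mat[OF _ burau_gram_carrier] mult_carrier_mat[OF burau_gram_carrier])

text \<open>The vector \<open>Q u\<close> is \<open>z\<^sup>-\<^sup>1 (- 2, 1, 0, \<dots>, 0)\<close>, which is \<open>z\<^sup>-\<^sup>1\<close> times the first row of the tilde matrix
  of \<open>\<alpha>\<^sub>1\<close> minus the identity. The identity is checked for the transposes, because the hypothesis
  concerns the transpose of \<open>a\<close>.\<close>

lemma burau_gram_intertwines_alpha:
  assumes z: "z \<noteq> 0" and n: "2 \<le> n" and a: "a \<in> carrier_mat (n - 1) (n - 1)" and u: "u \<in> coord_space n"
    and f1: "burau_form z 1 u = - 2" and f2: "burau_form z 2 u = z"
    and f: "\<And>j. 3 \<le> j \<Longrightarrow> j < n \<Longrightarrow> burau_form z j u = 0"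
    and act: "\<And>x. x \<in> coord_space n \<Longrightarrow> act n (transpose_mat a) x = (\<lambda>i. c * (x i + burau_form z 1 x * u i))"
  shows "a * burau_gram n z = burau_gram n z * (c \<cdot>\<^sub>m nbr_mat n 1 (- 1) 1 1)"
proof -
  let ?Q = "burau_gram n z" and ?N = "nbr_mat n 1 (- 1) 1 1"
  have ta: "transpose_mat a \<in> carrier_mat (n - 1) (n - 1)" using a by simp
  have tN: "transpose_mat ?N \<in> carrier_mat (n - 1) (n - 1)" by simp
  have i: "1 \<le> (1::nat)" "1 < n" "0 < (1::nat)" using n by auto
  have eq: "?Q * transpose_mat a = (c \<cdot>\<^sub>m transpose_mat ?N) * ?Q"
  proof (rule act_eqI)
    fix x assume x: "x \<in> coord_space n"
    show "act n (?Q * transpose_mat a) x = act n ((c \<cdot>\<^sub>m transpose_mat ?N) * ?Q) x"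
      unfolding act_mult[OF burau_gram_carrier ta] act_mult[OF smult_carrier_mat[OF tN] burau_gram_carrier]
    proof
      fix k
      show "act n ?Q (act n (transpose_mat a) x) k = act n (c \<cdot>\<^sub>m transpose_mat ?N) (act n ?Q x) k"
      proof (cases "0 < k \<and> k < n")
        case True
        then have k: "1 \<le> k" "k < n" "0 < k" by auto
        consider "k = 1" | "k = 2" | "3 \<le> k" using k by linarith
        then have coef: "inverse z ^ k * burau_form z k u = inverse z ^ 1 * nbr_coeff 1 (- 1 - 1) 1 1 k"
          using z k f1 f2 f by cases (auto simp: nbr_coeff_def power2_eq_square)
        have r: "act n (transpose_mat a) x = (\<lambda>i. c * x i + (c * burau_form z 1 x) * u i)"
          unfolding act[OF x] by (simp add: algebra_simps)
        have "act n ?Q (act n (transpose_mat a) x) k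
            = inverse z ^ k * (c * burau_form z k x + (c * burau_form z 1 x) * burau_form z k u)"
          unfolding act_burau_gram[OF act_in k(3,2)] unfolding r burau_form_comb ..
        also have "\<dots> = c * (inverse z ^ k * burau_form z k x
            + burau_form z 1 x * (inverse z ^ k * burau_form z k u))"
          by (simp add: algebra_simps)
        also have "\<dots> = act n (c \<cdot>\<^sub>m transpose_mat ?N) (act n ?Q x) k"
          unfolding act_smult[OF tN] act_transpose_nbr_mat[OF i(1,2) k(1,2)] act_burau_gram[OF x k(3,2)]
            act_burau_gram[OF x i(3,2)] coef by (simp add: algebra_simps)
        finally show ?thesis .
      qed (simp add: act_outside)
    qed
  qed (auto intro!: mult_carrier_mat[OF _ burau_gram_carrier] mult_carrier_mat[OF burau_gram_carrier] a)
  have s: "transpose_mat (c \<cdot>\<^sub>m transpose_mat ?N) = c \<cdot>\<^sub>m ?N" by (auto intro!: eq_matI)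
  have "transpose_mat (?Q * transpose_mat a) = transpose_mat ((c \<cdot>\<^sub>m transpose_mat ?N) * ?Q)" using eq by simp
  then show ?thesis
    unfolding transpose_mult[OF burau_gram_carrier ta] transpose_mult[OF smult_carrier_mat[OF tN] burau_gram_carrier]
      burau_gram_symmetric[OF z] s by simp
qed

section \<open>Equivalence and traces\<close>

lemma conjugate_hom:
  assumes K: "group K" and r: "\<rho> \<in> hom G K" and P: "P \<in> carrier K"
  shows "(\<lambda>g. P \<otimes>\<^bsub>K\<^esub> \<rho> g \<otimes>\<^bsub>K\<^esub> inv\<^bsub>K\<^esub> P) \<in> hom G K"
proof (rule homI)
  interpret K: group K by (rule K)
  fix g assume g: "g \<in> carrier G"
  have mg: "\<rho> g \<in> carrier K" using hom_in_carrier[OF r g] .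
  then show "P \<otimes>\<^bsub>K\<^esub> \<rho> g \<otimes>\<^bsub>K\<^esub> inv\<^bsub>K\<^esub> P \<in> carrier K" using P by simp
  fix h assume h: "h \<in> carrier G"
  have mh: "\<rho> h \<in> carrier K" using hom_in_carrier[OF r h] .
  have "inv\<^bsub>K\<^esub> P \<otimes>\<^bsub>K\<^esub> (P \<otimes>\<^bsub>K\<^esub> (\<rho> h \<otimes>\<^bsub>K\<^esub> inv\<^bsub>K\<^esub> P)) = \<rho> h \<otimes>\<^bsub>K\<^esub> inv\<^bsub>K\<^esub> P"
    using P mh K.m_assoc[of "inv\<^bsub>K\<^esub> P" P "\<rho> h \<otimes>\<^bsub>K\<^esub> inv\<^bsub>K\<^esub> P"] by simp
  then show "P \<otimes>\<^bsub>K\<^esub> \<rho> (g \<otimes>\<^bsub>G\<^esub> h) \<otimes>\<^bsub>K\<^esub> inv\<^bsub>K\<^esub> P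
      = (P \<otimes>\<^bsub>K\<^esub> \<rho> g \<otimes>\<^bsub>K\<^esub> inv\<^bsub>K\<^esub> P) \<otimes>\<^bsub>K\<^esub> (P \<otimes>\<^bsub>K\<^esub> \<rho> h \<otimes>\<^bsub>K\<^esub> inv\<^bsub>K\<^esub> P)"
    using P mg mh hom_mult[OF r g h] by (simp add: K.m_assoc)
qed

lemma rep_equiv_trans:
  assumes r: "\<rho> \<in> hom G (GL m)" and 1: "rep_equiv G m \<rho> \<rho>'" and 2: "rep_equiv G m \<rho>' \<rho>''"
  shows "rep_equiv G m \<rho> \<rho>''"
proof -
  interpret K: group "GL m" by (rule group_GL)
  obtain P where P: "P \<in> carrier (GL m)"
    and P': "\<And>g. g \<in> carrier G \<Longrightarrow> \<rho>' g = P \<otimes>\<^bsub>GL m\<^esub> \<rho> g \<otimes>\<^bsub>GL m\<^esub> inv\<^bsub>GL m\<^esub> P"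
    using 1 unfolding rep_equiv_def by blast
  obtain Q where Q: "Q \<in> carrier (GL m)"
    and Q': "\<And>g. g \<in> carrier G \<Longrightarrow> \<rho>'' g = Q \<otimes>\<^bsub>GL m\<^esub> \<rho>' g \<otimes>\<^bsub>GL m\<^esub> inv\<^bsub>GL m\<^esub> Q"
    using 2 unfolding rep_equiv_def by blast
  have "\<rho>'' g = (Q \<otimes>\<^bsub>GL m\<^esub> P) \<otimes>\<^bsub>GL m\<^esub> \<rho> g \<otimes>\<^bsub>GL m\<^esub> inv\<^bsub>GL m\<^esub> (Q \<otimes>\<^bsub>GL m\<^esub> P)" if g: "g \<in> carrier G" for g
    using P Q hom_in_carrier[OF r g] unfolding Q'[OF g] P'[OF g]
    by (simp add: K.m_assoc K.inv_mult_group del: GL_simps)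
  then show ?thesis unfolding rep_equiv_def using K.m_closed[OF Q P] by blast
qed

definition mat_trace :: "complex mat \<Rightarrow> complex" where
  "mat_trace A = (\<Sum>i<dim_row A. A $$ (i, i))"

lemma mat_trace_commute:
  assumes "A \<in> carrier_mat m m" "B \<in> carrier_mat m m"
  shows "mat_trace (A * B) = mat_trace (B * A)"
proof -
  have "mat_trace (A * B) = (\<Sum>i<m. \<Sum>k<m. A $$ (i, k) * B $$ (k, i))"
    using assms by (simp add: mat_trace_def scalar_prod_def atLeast0LessThan)
  also have "\<dots> = (\<Sum>k<m. \<Sum>i<m. A $$ (i, k) * B $$ (k, i))" by (rule sum.swap)
  also have "\<dots> = mat_trace (B * A)"
    using assms by (simp add: mat_trace_def scalar_prod_def atLeast0LessThan mult.commute)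
  finally show ?thesis .
qed

lemma mat_trace_conjugate:
  assumes P: "P \<in> carrier (GL m)" and A: "A \<in> carrier_mat m m"
  shows "mat_trace (P \<otimes>\<^bsub>GL m\<^esub> A \<otimes>\<^bsub>GL m\<^esub> inv\<^bsub>GL m\<^esub> P) = mat_trace A"
proof -
  have c: "P \<in> carrier_mat m m" "inv\<^bsub>GL m\<^esub> P \<in> carrier_mat m m" using P GL_inv(1)[OF P] GL_carrier_mat by auto
  have "mat_trace (P * A * inv\<^bsub>GL m\<^esub> P) = mat_trace (inv\<^bsub>GL m\<^esub> P * (P * A))"
    by (rule mat_trace_commute) (use c A in auto)
  also have "inv\<^bsub>GL m\<^esub> P * (P * A) = (inv\<^bsub>GL m\<^esub> P * P) * A" using c A by (simp add: assoc_mult_mat[of _ m m _ m _ m])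
  also have "\<dots> = A" using GL_inv(3)[OF P] A by simp
  finally show ?thesis by simp
qed

lemma mat_trace_smult: "mat_trace (k \<cdot>\<^sub>m A) = k * mat_trace A" if "A \<in> carrier_mat m m"
  using that by (simp add: mat_trace_def sum_distrib_left)

lemma mat_trace_transpose: "mat_trace (transpose_mat A) = mat_trace A" if "A \<in> carrier_mat m m"
  using that by (simp add: mat_trace_def)

lemma mat_trace_act:
  assumes A: "A \<in> carrier_mat (n - 1) (n - 1)"
  shows "mat_trace A = (\<Sum>j=1..<n. act n A (unit_coord j) j)"
proof -
  have "(\<Sum>j=1..<n. act n A (unit_coord j) j) = (\<Sum>j=1..<n. A $$ (j - 1, j - 1))"
    by (rule sum.cong) (auto simp: act_unit_coord)
  also have "\<dots> = (\<Sum>i<n - 1. A $$ (i, i))"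
    by (rule sum.reindex_bij_witness[of _ Suc "\<lambda>j. j - 1"]) auto
  finally show ?thesis using A by (simp add: mat_trace_def)
qed

lemma sum_two_then_ones:
  fixes g :: "nat \<Rightarrow> complex"
  assumes "3 \<le> n" and "\<And>j. 3 \<le> j \<Longrightarrow> j < n \<Longrightarrow> g j = 1"
  shows "(\<Sum>j=1..<n. g j) = g 1 + g 2 + of_nat (n - 3)"
proof -
  have "{1..<n} = insert 1 (insert 2 {3..<n})" using assms(1) by auto
  moreover have "(\<Sum>j=3..<n. g j) = (\<Sum>j=3..<n. 1)" by (rule sum.cong) (auto simp: assms(2))
  ultimately show ?thesis by (simp add: add.assoc)
qed

lemma trace_alpha:
  assumes n: "5 \<le> n"
  shows "mat_trace (wb_mat n s z (Alpha 1)) = of_nat (n - 3)"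
proof -
  have c: "wb_mat n s z (Alpha 1) \<in> carrier_mat (n - 1) (n - 1)" by (simp add: wb_mat_def)
  have g: "Alpha 1 \<in> wb_gens n" using n by (auto simp: wb_gens_def)
  have "act n (wb_mat n s z (Alpha 1)) (unit_coord j) j = (if j = 1 then - 1 else 1)" if "1 \<le> j" "j < n" for j
    using act_wb_mat[OF g unit_coord_in[OF that]] that by (auto simp: nbr_update_apply unit_coord_apply)
  then have "mat_trace (wb_mat n s z (Alpha 1)) = (\<Sum>j=1..<n. if j = 1 then - 1 else 1)"
    unfolding mat_trace_act[OF c] by (intro sum.cong) auto
  also have "\<dots> = of_nat (n - 3)" using n by (subst sum_two_then_ones) auto
  finally show ?thesis .
qed

lemma trace_sigma_alpha:
  assumes n: "5 \<le> n"
  shows "mat_trace (wb_mat n s z (Sigma 1) * wb_mat n s z (Alpha 2)) = s - z - 1 + of_nat (n - 3)"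
proof -
  have c: "wb_mat n s z (Sigma 1) \<in> carrier_mat (n - 1) (n - 1)" "wb_mat n s z (Alpha 2) \<in> carrier_mat (n - 1) (n - 1)"
    by (simp_all add: wb_mat_def)
  have g: "Sigma 1 \<in> wb_gens n" "Alpha 2 \<in> wb_gens n" using n by (auto simp: wb_gens_def)
  have v: "act n (wb_mat n s z (Sigma 1) * wb_mat n s z (Alpha 2)) (unit_coord j) j
      = (if j = 1 then s - z else if j = 2 then - 1 else 1)" if j: "1 \<le> j" "j < n" for j
  proof -
    have "act n (wb_mat n s z (Sigma 1) * wb_mat n s z (Alpha 2)) (unit_coord j) j
        = wb_op s z (Sigma 1) (wb_op s z (Alpha 2) (unit_coord j)) j"
      unfolding act_mult[OF c] using act_wb_mat[OF g(1)] act_wb_mat[OF g(2)] unit_coord_in[OF j] by metis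
    then show ?thesis using j by (auto simp: nbr_update_apply unit_coord_apply)
  qed
  have "mat_trace (wb_mat n s z (Sigma 1) * wb_mat n s z (Alpha 2))
      = (\<Sum>j=1..<n. if j = 1 then s - z else if j = 2 then - 1 else 1)"
    unfolding mat_trace_act[OF mult_carrier_mat[OF c]] by (rule sum.cong) (use v in auto)
  also have "\<dots> = s - z - 1 + of_nat (n - 3)" using n by (subst sum_two_then_ones) auto
  finally show ?thesis .
qed

section \<open>Extensions of the Burau representation\<close>

lemma wb_relations_intros:
  "1 \<le> i \<Longrightarrow> i < n \<Longrightarrow> ([Alpha i, Alpha i], []) \<in> wb_relations n"
  "1 \<le> i \<Longrightarrow> i + 2 \<le> j \<Longrightarrow> j < n \<Longrightarrow> ([Alpha i, Alpha j], [Alpha j, Alpha i]) \<in> wb_relations n"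
  "1 \<le> i \<Longrightarrow> i + 2 \<le> j \<Longrightarrow> j < n \<Longrightarrow> ([Alpha i, Sigma j], [Sigma j, Alpha i]) \<in> wb_relations n"
  "1 \<le> i \<Longrightarrow> i + 1 < n \<Longrightarrow>
     ([Alpha i, Alpha (i + 1), Sigma i], [Sigma (i + 1), Alpha i, Alpha (i + 1)]) \<in> wb_relations n"
  "1 \<le> i \<Longrightarrow> i + 1 < n \<Longrightarrow>
     ([Sigma i, Sigma (i + 1), Alpha i], [Alpha (i + 1), Sigma i, Sigma (i + 1)]) \<in> wb_relations n"
  unfolding wb_relations_def by auto

text \<open>Translation of \<open>alpha_one_dichotomy\<close>: reading a defining relation from left to right as a
  composition of transposed images gives exactly the identities assumed there.\<close>

lemma rep_alpha_one:
  assumes n: "5 \<le> n" and z: "z \<noteq> 0" and R: "R \<in> hom (welded_braid_group n) (GL (n - 1))"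
    and sigma: "\<And>i. 1 \<le> i \<Longrightarrow> i < n \<Longrightarrow> R (wb_elem n (Sigma i)) = transpose_mat (nbr_mat n z (- z) 1 i)"
  obtains c where "c = 1 \<or> c = - 1"
      and "\<And>x. x \<in> coord_space n \<Longrightarrow> act n (transpose_mat (R (wb_elem n (Alpha 1)))) x
             = (\<lambda>i. c * (x i + (- 2 * x 1 + x 2 / z) * unit_coord 1 i))"
    | c u where "c = 1 \<or> c = - 1" and "u \<in> coord_space n"
      and "burau_form z 1 u = - 2" and "burau_form z 2 u = z"
      and "\<And>j. 3 \<le> j \<Longrightarrow> j < n \<Longrightarrow> burau_form z j u = 0"
      and "\<And>x. x \<in> coord_space n \<Longrightarrow> act n (transpose_mat (R (wb_elem n (Alpha 1)))) x
             = (\<lambda>i. c * (x i + burau_form z 1 x * u i))"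
proof -
  define T where "T g = act n (transpose_mat (R (wb_elem n g)))" for g
  have mem: "R (wb_elem n g) \<in> carrier (GL (n - 1))" if "g \<in> wb_gens n" for g
    using hom_in_carrier[OF R wb_elem_in[OF that]] .
  have rel: "fold T u x = fold T v x" if uv: "(u, v) \<in> wb_relations n" and x: "x \<in> coord_space n" for u v x
  proof -
    have "act n (transpose_mat (eval_list (GL (n - 1)) (\<lambda>g. R (wb_elem n g)) w)) x = fold T w x"
      if "set w \<subseteq> wb_gens n" for w
      using act_transpose_eval_list[of w "\<lambda>g. R (wb_elem n g)" n x] mem that x
      unfolding T_def by blast
    then show ?thesis
      using hom_wb_relation[OF group_GL R uv] wb_relations_gens[OF uv] by metis
  qed
  have S: "T (Sigma i) x = burau_step z i x" if "1 \<le> i" "i < n" "x \<in> coord_space n" for i x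
    using that by (simp add: T_def sigma act_nbr_mat)
  have TV: "T g x \<in> coord_space n" for g x by (simp add: T_def)
  have lin: "linear_op n (T g)" for g unfolding T_def by (rule linear_op_act)
  have in_rel: "([Alpha 1, Alpha 1], []) \<in> wb_relations n"
    "3 \<le> j \<Longrightarrow> j < n \<Longrightarrow> ([Alpha 1, Sigma j], [Sigma j, Alpha 1]) \<in> wb_relations n"
    "([Sigma 1, Sigma 2, Alpha 1], [Alpha 2, Sigma 1, Sigma 2]) \<in> wb_relations n"
    "([Sigma 2, Sigma 3, Alpha 2], [Alpha 3, Sigma 2, Sigma 3]) \<in> wb_relations n"
    "([Alpha 1, Alpha 3], [Alpha 3, Alpha 1]) \<in> wb_relations n"
    "([Alpha 1, Alpha 2, Sigma 1], [Sigma 2, Alpha 1, Alpha 2]) \<in> wb_relations n" for j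
    using n wb_relations_intros(1)[of 1 n] wb_relations_intros(3)[of 1 j n] wb_relations_intros(5)[of 1 n]
      wb_relations_intros(5)[of 2 n] wb_relations_intros(2)[of 1 3 n] wb_relations_intros(4)[of 1 n]
    by simp_all
  have A1_invol: "T (Alpha 1) (T (Alpha 1) x) = x" if "x \<in> coord_space n" for x
    using rel[OF in_rel(1) that] by simp
  have A1_com: "T (Alpha 1) (burau_step z j x) = burau_step z j (T (Alpha 1) x)"
    if "3 \<le> j" "j < n" "x \<in> coord_space n" for j x
    using rel[OF in_rel(2)[OF that(1,2)] that(3)] S[of j] that TV by simp
  have shift12: "T (Alpha 1) (burau_step z 2 (burau_step z 1 x)) = burau_step z 2 (burau_step z 1 (T (Alpha 2) x))"
    if "x \<in> coord_space n" for x
    using rel[OF in_rel(3) that] S[of 1] S[of 2] n that TV by simp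
  have shift23: "T (Alpha 2) (burau_step z 3 (burau_step z 2 x)) = burau_step z 3 (burau_step z 2 (T (Alpha 3) x))"
    if "x \<in> coord_space n" for x
    using rel[OF in_rel(4) that] S[of 2] S[of 3] n that TV by simp
  have com13: "T (Alpha 1) (T (Alpha 3) x) = T (Alpha 3) (T (Alpha 1) x)" if "x \<in> coord_space n" for x
    using rel[OF in_rel(5) that] by simp
  have mixed: "burau_step z 1 (T (Alpha 2) (T (Alpha 1) x)) = T (Alpha 2) (T (Alpha 1) (burau_step z 2 x))"
    if "x \<in> coord_space n" for x
    using rel[OF in_rel(6) that] S[of 1] S[of 2] n that TV by simp
  show thesis
  proof (rule alpha_one_dichotomy[OF n z lin lin lin])
    fix c assume "c = 1 \<or> c = - 1"
      "\<And>x. x \<in> coord_space n \<Longrightarrow> T (Alpha 1) x = (\<lambda>i. c * (x i + (- 2 * x 1 + x 2 / z) * unit_coord 1 i))"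
    then show thesis unfolding T_def by (rule that(1))
  next
    fix c u assume "c = 1 \<or> c = - 1" "u \<in> coord_space n"
      "burau_form z 1 u = - 2" "burau_form z 2 u = z"
      "\<And>j. 3 \<le> j \<Longrightarrow> j < n \<Longrightarrow> burau_form z j u = 0"
      "\<And>x. x \<in> coord_space n \<Longrightarrow> T (Alpha 1) x = (\<lambda>i. c * (x i + burau_form z 1 x * u i))"
    then show thesis unfolding T_def by (rule that(2))
  qed (fact A1_invol, fact A1_com, fact shift12, fact shift23, fact com13, fact mixed)
qed

text \<open>Since \<open>X\<^sub>n(1, c)\<close> is trivial on the \<open>\<sigma>\<^sub>i\<close>, a twist changes only the image of \<open>\<alpha>\<^sub>1\<close>, by the factor \<open>c\<close>.\<close>

lemma agrees_with_twist:
  assumes n: "2 \<le> n" and c: "c = 1 \<or> c = - 1"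
    and R: "R \<in> hom (welded_braid_group n) (GL (n - 1))"
    and B: "\<beta> \<in> hom (welded_braid_group n) (GL (n - 1))"
    and sigma: "\<And>i. 1 \<le> i \<Longrightarrow> i < n \<Longrightarrow> R (wb_elem n (Sigma i)) = \<beta> (wb_elem n (Sigma i))"
    and alpha: "R (wb_elem n (Alpha 1)) = c \<cdot>\<^sub>m \<beta> (wb_elem n (Alpha 1))"
    and g: "g \<in> carrier (welded_braid_group n)"
  shows "char_tensor (welded_braid_group n) (X_rep n 1 c) \<beta> g = R g"
proof (rule hom_determined_by_sigmas_and_alpha_one[OF group_GL _ R _ _ g])
  show "char_tensor (welded_braid_group n) (X_rep n 1 c) \<beta> \<in> hom (welded_braid_group n) (GL (n - 1))"
    by (rule char_tensor_hom[OF group_welded_braid X_rep_character(1)[OF c] B])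
  fix i assume "1 \<le> i" "i < n"
  then have s: "Sigma i \<in> wb_gens n" by (auto simp: wb_gens_def)
  show "char_tensor (welded_braid_group n) (X_rep n 1 c) \<beta> (wb_elem n (Sigma i)) = R (wb_elem n (Sigma i))"
    using sigma[OF \<open>1 \<le> i\<close> \<open>i < n\<close>] wb_elem_in[OF s] X_rep_character(2)[OF c s]
    by (auto simp: char_tensor_def intro!: eq_matI)
next
  have a: "Alpha 1 \<in> wb_gens n" using n by (auto simp: wb_gens_def)
  show "char_tensor (welded_braid_group n) (X_rep n 1 c) \<beta> (wb_elem n (Alpha 1)) = R (wb_elem n (Alpha 1))"
    using alpha wb_elem_in[OF a] X_rep_character(2)[OF c a] by (simp add: char_tensor_def)
qed

lemma rep_equiv_cong:
  assumes "rep_equiv G m \<rho> \<rho>'" "\<And>g. g \<in> carrier G \<Longrightarrow> \<rho>'' g = \<rho>' g"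
  shows "rep_equiv G m \<rho> \<rho>''"
  using assms unfolding rep_equiv_def by auto

lemma twisted_hat_eq:
  assumes n: "5 \<le> n" and z: "z \<noteq> 0" and R: "R \<in> hom (welded_braid_group n) (GL (n - 1))"
    and sigma: "\<And>i. 1 \<le> i \<Longrightarrow> i < n \<Longrightarrow> R (wb_elem n (Sigma i)) = transpose_mat (nbr_mat n z (- z) 1 i)"
    and c: "c = 1 \<or> c = - 1"
    and act: "\<And>x. x \<in> coord_space n \<Longrightarrow> act n (transpose_mat (R (wb_elem n (Alpha 1)))) x
             = (\<lambda>i. c * (x i + (- 2 * x 1 + x 2 / z) * unit_coord 1 i))"
    and g: "g \<in> carrier (welded_braid_group n)"
  shows "char_tensor (welded_braid_group n) (X_rep n 1 c) (burau_hat n z) g = R g"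
proof (rule agrees_with_twist[OF _ c R burau_hat_rep(1)[OF n z] _ _ g])
  show "2 \<le> n" using n by simp
  fix i assume i: "1 \<le> i" "i < n"
  then have "Sigma i \<in> wb_gens n" by (auto simp: wb_gens_def)
  then show "R (wb_elem n (Sigma i)) = burau_hat n z (wb_elem n (Sigma i))"
    using sigma[OF i] burau_hat_rep(2)[OF n z] by (simp add: wb_mat_def)
next
  have a: "Alpha 1 \<in> wb_gens n" using n by (auto simp: wb_gens_def)
  have i: "1 \<le> (1::nat)" "1 < n" using n by auto
  let ?N = "nbr_mat n z (- 1) (1 / z) 1"
  have Ra: "R (wb_elem n (Alpha 1)) \<in> carrier_mat (n - 1) (n - 1)"
    using GL_carrier_mat[OF hom_in_carrier[OF R wb_elem_in[OF a]]] .
  have "transpose_mat (R (wb_elem n (Alpha 1))) = c \<cdot>\<^sub>m ?N"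
  proof (rule act_eqI)
    fix x assume x: "x \<in> coord_space n"
    show "act n (transpose_mat (R (wb_elem n (Alpha 1)))) x = act n (c \<cdot>\<^sub>m ?N) x"
      unfolding act[OF x] using x
      by (auto simp: fun_eq_iff act_smult act_nbr_mat[OF i x] nbr_update_apply unit_coord_apply algebra_simps)
  qed (use Ra in auto)
  then have "transpose_mat (transpose_mat (R (wb_elem n (Alpha 1)))) = transpose_mat (c \<cdot>\<^sub>m ?N)" by simp
  also have "transpose_mat (c \<cdot>\<^sub>m ?N) = c \<cdot>\<^sub>m transpose_mat ?N" by (auto intro!: eq_matI)
  finally show "R (wb_elem n (Alpha 1)) = c \<cdot>\<^sub>m burau_hat n z (wb_elem n (Alpha 1))"
    using burau_hat_rep(2)[OF n z a] by (simp add: wb_mat_def)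
qed

lemma twisted_tilde_equiv:
  assumes n: "5 \<le> n" and z: "z \<noteq> 0" and P: "(\<Sum>i<n. z ^ i) \<noteq> 0"
    and R: "R \<in> hom (welded_braid_group n) (GL (n - 1))"
    and sigma: "\<And>i. 1 \<le> i \<Longrightarrow> i < n \<Longrightarrow> R (wb_elem n (Sigma i)) = transpose_mat (nbr_mat n z (- z) 1 i)"
    and c: "c = 1 \<or> c = - 1" and u: "u \<in> coord_space n"
    and f1: "burau_form z 1 u = - 2" and f2: "burau_form z 2 u = z"
    and f: "\<And>j. 3 \<le> j \<Longrightarrow> j < n \<Longrightarrow> burau_form z j u = 0"
    and act: "\<And>x. x \<in> coord_space n \<Longrightarrow> act n (transpose_mat (R (wb_elem n (Alpha 1)))) x
             = (\<lambda>i. c * (x i + burau_form z 1 x * u i))"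
  shows "rep_equiv (welded_braid_group n) (n - 1) R
    (char_tensor (welded_braid_group n) (X_rep n 1 c) (burau_tilde n z))"
proof -
  let ?K = "GL (n - 1)" and ?Q = "burau_gram n z"
  interpret K: group ?K by (rule group_GL)
  have n2: "2 \<le> n" using n by simp
  have Q: "?Q \<in> carrier ?K" by (rule burau_gram_in_GL[OF z n2 P])
  \<comment> \<open>Conjugation by \<open>Q'\<close> turns the Burau matrices into those with a tilde.\<close>
  define Q' where "Q' = inv\<^bsub>?K\<^esub> ?Q"
  have Q': "Q' \<in> carrier ?K" "Q' * ?Q = 1\<^sub>m (n - 1)" and invQ': "inv\<^bsub>?K\<^esub> Q' = ?Q"
    using GL_inv[OF Q] Q by (auto simp: Q'_def)
  define R' where "R' g = Q' \<otimes>\<^bsub>?K\<^esub> R g \<otimes>\<^bsub>?K\<^esub> inv\<^bsub>?K\<^esub> Q'" for g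
  have R': "R' \<in> hom (welded_braid_group n) ?K" unfolding R'_def by (rule conjugate_hom[OF group_GL R Q'(1)])
  have conj: "R' g = b" if g: "g \<in> carrier (welded_braid_group n)" and b: "b \<in> carrier_mat (n - 1) (n - 1)"
    and eq: "R g * ?Q = ?Q * b" for g b
  proof -
    have cm: "Q' \<in> carrier_mat (n - 1) (n - 1)" "R g \<in> carrier_mat (n - 1) (n - 1)"
      using Q'(1) hom_in_carrier[OF R g] GL_carrier_mat by auto
    have "R' g = Q' * (R g * ?Q)"
      unfolding R'_def invQ' by (simp add: assoc_mult_mat[OF cm burau_gram_carrier])
    also have "\<dots> = (Q' * ?Q) * b"
      unfolding eq by (rule assoc_mult_mat[OF cm(1) burau_gram_carrier b, symmetric])
    also have "\<dots> = b" using Q'(2) b by simp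
    finally show ?thesis .
  qed
  have gens: "Sigma i \<in> wb_gens n" "Alpha i \<in> wb_gens n" if "1 \<le> i" "i < n" for i
    using that by (auto simp: wb_gens_def)
  have "char_tensor (welded_braid_group n) (X_rep n 1 c) (burau_tilde n z) g = R' g"
    if g: "g \<in> carrier (welded_braid_group n)" for g
  proof (rule agrees_with_twist[OF n2 c R' burau_tilde_rep(1)[OF n z] _ _ g])
    fix i assume i: "1 \<le> i" "i < n"
    have "R' (wb_elem n (Sigma i)) = nbr_mat n z (- z) 1 i"
      by (rule conj[OF wb_elem_in[OF gens(1)[OF i]] nbr_mat_carrier])
        (simp add: sigma[OF i] burau_gram_intertwines_sigma[OF z i])
    then show "R' (wb_elem n (Sigma i)) = burau_tilde n z (wb_elem n (Sigma i))"
      using burau_tilde_rep(2)[OF n z gens(1)[OF i]] by (simp add: wb_mat_def)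
  next
    have i: "1 \<le> (1::nat)" "1 < n" using n by auto
    have a: "wb_elem n (Alpha 1) \<in> carrier (welded_braid_group n)" by (rule wb_elem_in[OF gens(2)[OF i]])
    have "R' (wb_elem n (Alpha 1)) = c \<cdot>\<^sub>m nbr_mat n 1 (- 1) 1 1"
      by (rule conj[OF a smult_carrier_mat[OF nbr_mat_carrier]])
        (rule burau_gram_intertwines_alpha[OF z n2 GL_carrier_mat[OF hom_in_carrier[OF R a]] u f1 f2 f act])
    then show "R' (wb_elem n (Alpha 1)) = c \<cdot>\<^sub>m burau_tilde n z (wb_elem n (Alpha 1))"
      using burau_tilde_rep(2)[OF n z gens(2)[OF i]] by (simp add: wb_mat_def)
  qed
  moreover have "rep_equiv (welded_braid_group n) (n - 1) R R'"
    unfolding rep_equiv_def R'_def using Q'(1) by blast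
  ultimately show ?thesis by (rule rep_equiv_cong[rotated])
qed

text \<open>The trace at \<open>\<alpha>\<^sub>1\<close> detects \<open>k\<close>. The trace at \<open>\<sigma>\<^sub>1 \<alpha>\<^sub>2\<close> then detects \<open>s\<close>, and this separates the two
  families unless \<open>z = 1\<close>. The traces at \<open>\<sigma>\<^sub>1 \<alpha>\<^sub>1\<close> would not: they agree for both families.\<close>

lemma twist_invariants:
  assumes n: "5 \<le> n" and z: "z \<noteq> 0" and k: "k = 1 \<or> k = - 1"
    and \<rho>: "\<rho> \<in> hom (welded_braid_group n) (GL (n - 1))"
    and \<beta>: "\<beta> = burau_tilde n z \<and> s = 1 \<or> \<beta> = burau_hat n z \<and> s = z"
    and eq: "rep_equiv (welded_braid_group n) (n - 1) \<rho> (char_tensor (welded_braid_group n) (X_rep n 1 k) \<beta>)"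
  shows "mat_trace (\<rho> (wb_elem n (Alpha 1))) = k * of_nat (n - 3)"
    and "mat_trace (\<rho> (wb_elem n (Sigma 1) \<otimes>\<^bsub>welded_braid_group n\<^esub> wb_elem n (Alpha 2)))
           = k * (s - z - 1 + of_nat (n - 3))"
proof -
  let ?G = "welded_braid_group n"
  interpret G: group ?G by (rule group_welded_braid)
  have gens: "Alpha 1 \<in> wb_gens n" "Sigma 1 \<in> wb_gens n" "Alpha 2 \<in> wb_gens n"
    using n by (auto simp: wb_gens_def)
  note mem = wb_elem_in[OF gens(1)] wb_elem_in[OF gens(2)] wb_elem_in[OF gens(3)]
  obtain P where P: "P \<in> carrier (GL (n - 1))"
    and conj: "\<And>g. g \<in> carrier ?G \<Longrightarrow> char_tensor ?G (X_rep n 1 k) \<beta> g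
                = P \<otimes>\<^bsub>GL (n - 1)\<^esub> \<rho> g \<otimes>\<^bsub>GL (n - 1)\<^esub> inv\<^bsub>GL (n - 1)\<^esub> P"
    using eq unfolding rep_equiv_def by blast
  have \<beta>hom: "\<beta> \<in> hom ?G (GL (n - 1))"
    using \<beta> burau_tilde_rep(1)[OF n z] burau_hat_rep(1)[OF n z] by auto
  have tr: "mat_trace (\<rho> g) = X_rep n 1 k g * mat_trace (\<beta> g)" if g: "g \<in> carrier ?G" for g
  proof -
    have "mat_trace (\<rho> g) = mat_trace (char_tensor ?G (X_rep n 1 k) \<beta> g)"
      unfolding conj[OF g] by (rule mat_trace_conjugate[OF P GL_carrier_mat[OF hom_in_carrier[OF \<rho> g]], symmetric])
    then show ?thesis
      using g mat_trace_smult[OF GL_carrier_mat[OF hom_in_carrier[OF \<beta>hom g]]] by (simp add: char_tensor_def)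
  qed
  have c: "wb_mat n s z g \<in> carrier_mat (n - 1) (n - 1)" for g by (cases g) (simp_all add: wb_mat_def)
  have val: "(\<forall>g\<in>wb_gens n. \<beta> (wb_elem n g) = wb_mat n s z g)
      \<or> (\<forall>g\<in>wb_gens n. \<beta> (wb_elem n g) = transpose_mat (wb_mat n s z g))"
    using \<beta> burau_tilde_rep(2)[OF n z] burau_hat_rep(2)[OF n z] by auto
  have "mat_trace (\<beta> (wb_elem n (Alpha 1))) = mat_trace (wb_mat n s z (Alpha 1))"
    using val gens mat_trace_transpose[OF c] by auto
  then show "mat_trace (\<rho> (wb_elem n (Alpha 1))) = k * of_nat (n - 3)"
    using tr[OF mem(1)] X_rep_character(2)[OF k gens(1)] trace_alpha[OF n] by simp
  have "mat_trace (\<beta> (wb_elem n (Sigma 1)) * \<beta> (wb_elem n (Alpha 2)))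
      = mat_trace (wb_mat n s z (Sigma 1) * wb_mat n s z (Alpha 2))"
    using val
  proof
    assume "\<forall>g\<in>wb_gens n. \<beta> (wb_elem n g) = transpose_mat (wb_mat n s z g)"
    then have "\<beta> (wb_elem n (Sigma 1)) * \<beta> (wb_elem n (Alpha 2))
        = transpose_mat (wb_mat n s z (Alpha 2) * wb_mat n s z (Sigma 1))"
      using gens transpose_mult[OF c c] by simp
    then show ?thesis
      using mat_trace_transpose[OF mult_carrier_mat[OF c c]] mat_trace_commute[OF c c] by simp
  qed (use gens in simp)
  then show "mat_trace (\<rho> (wb_elem n (Sigma 1) \<otimes>\<^bsub>?G\<^esub> wb_elem n (Alpha 2))) = k * (s - z - 1 + of_nat (n - 3))"
    using tr[OF G.m_closed[OF mem(2,3)]] hom_mult[OF \<beta>hom mem(2,3)] hom_mult[OF X_rep_character(1)[OF k] mem(2,3)]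
      X_rep_character(2)[OF k gens(2)] X_rep_character(2)[OF k gens(3)] trace_sigma_alpha[OF n, of s z]
    by (simp add: nonzero_complex_def)
qed

theorem theorem3p25:
  fixes n :: nat and z :: complex and \<rho> :: "wb_gen word set \<Rightarrow> complex mat"
  assumes "n = 5 \<or> n \<ge> 7"
    and "\<rho> \<in> hom (welded_braid_group n) (GL (n - 1))"
    and "z \<noteq> 0"
    and "(\<Sum>i<n. z ^ i) \<noteq> 0"
    and "rep_equiv (braid_subgroup n) (n - 1)
           (restrict \<rho> (carrier (braid_subgroup n))) (burau n z)"
  shows "\<exists>!p. case p of (k, \<beta>') \<Rightarrow>
           k \<in> {-1, 1} \<and>
           \<beta>' \<in> hom (welded_braid_group n) (GL (n - 1)) \<and>
           \<beta>' \<in> (if z \<noteq> 1 then {burau_tilde n z, burau_hat n z} else {burau_tilde n 1}) \<and>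
           rep_equiv (welded_braid_group n) (n - 1) \<rho>
             (char_tensor (welded_braid_group n) (X_rep n 1 k) \<beta>')"
proof -
  let ?G = "welded_braid_group n" and ?K = "GL (n - 1)"
  let ?B = "if z \<noteq> 1 then {burau_tilde n z, burau_hat n z} else {burau_tilde n 1}"
  have n: "5 \<le> n" using assms(1) by auto
  note \<rho> = assms(2) and z = assms(3) and P = assms(4)
  obtain C where C: "C \<in> carrier ?K"
    and C': "\<And>g. g \<in> carrier (braid_subgroup n) \<Longrightarrow> burau n z g = C \<otimes>\<^bsub>?K\<^esub> \<rho> g \<otimes>\<^bsub>?K\<^esub> inv\<^bsub>?K\<^esub> C"
    using assms(5) unfolding rep_equiv_def by auto
  define R where "R g = C \<otimes>\<^bsub>?K\<^esub> \<rho> g \<otimes>\<^bsub>?K\<^esub> inv\<^bsub>?K\<^esub> C" for g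
  have R: "R \<in> hom ?G ?K" unfolding R_def by (rule conjugate_hom[OF group_GL \<rho> C])
  have \<rho>R: "rep_equiv ?G (n - 1) \<rho> R" unfolding rep_equiv_def R_def using C by blast
  have sigma: "R (wb_elem n (Sigma i)) = transpose_mat (nbr_mat n z (- z) 1 i)" if "1 \<le> i" "i < n" for i
    using C'[OF burau_value(2)[OF n z that]] burau_value(1)[OF n z that] by (simp add: R_def)
  have tilde: "\<exists>k \<beta>'. k \<in> {-1, 1} \<and> \<beta>' \<in> ?B \<and> rep_equiv ?G (n - 1) \<rho> (char_tensor ?G (X_rep n 1 k) \<beta>')"
    if "c = 1 \<or> c = - 1" "u \<in> coord_space n" "burau_form z 1 u = - 2" "burau_form z 2 u = z"
      "\<And>j. 3 \<le> j \<Longrightarrow> j < n \<Longrightarrow> burau_form z j u = 0"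
      "\<And>x. x \<in> coord_space n \<Longrightarrow> act n (transpose_mat (R (wb_elem n (Alpha 1)))) x
             = (\<lambda>i. c * (x i + burau_form z 1 x * u i))" for c u
  proof -
    have "rep_equiv ?G (n - 1) R (char_tensor ?G (X_rep n 1 c) (burau_tilde n z))"
      by (rule twisted_tilde_equiv[OF n z P R sigma that])
    from rep_equiv_trans[OF \<rho> \<rho>R this] show ?thesis using that(1) by (intro exI[of _ c] exI[of _ "burau_tilde n z"]) auto
  qed
  have "\<exists>k \<beta>'. k \<in> {-1, 1} \<and> \<beta>' \<in> ?B \<and> rep_equiv ?G (n - 1) \<rho> (char_tensor ?G (X_rep n 1 k) \<beta>')"
  proof (rule rep_alpha_one[OF n z R sigma])
    fix c assume c: "c = 1 \<or> c = - 1"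
      and act: "\<And>x. x \<in> coord_space n \<Longrightarrow> act n (transpose_mat (R (wb_elem n (Alpha 1)))) x
             = (\<lambda>i. c * (x i + (- 2 * x 1 + x 2 / z) * unit_coord 1 i))"
    \<comment> \<open>For \<open>z = 1\<close> this solution is also of the second kind, with \<open>u = e\<^sub>1\<close>.\<close>
    show ?thesis
    proof (cases "z = 1")
      case True
      show ?thesis
      proof (rule tilde[OF c])
        show "unit_coord 1 \<in> coord_space n" using n by simp
        show "burau_form z 1 (unit_coord 1) = - 2" "burau_form z 2 (unit_coord 1) = z"
          using True by (auto simp: burau_form_unit)
        show "burau_form z j (unit_coord 1) = 0" if "3 \<le> j" for j using that by (auto simp: burau_form_unit)
        show "act n (transpose_mat (R (wb_elem n (Alpha 1)))) x = (\<lambda>i. c * (x i + burau_form z 1 x * unit_coord 1 i))"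
          if x: "x \<in> coord_space n" for x
          unfolding act[OF x] using True x by (simp add: burau_form_def)
      qed
    next
      case False
      have "rep_equiv ?G (n - 1) \<rho> (char_tensor ?G (X_rep n 1 c) (burau_hat n z))"
        by (rule rep_equiv_cong[OF \<rho>R twisted_hat_eq[OF n z R sigma c act]])
      then show ?thesis using c False by (intro exI[of _ c] exI[of _ "burau_hat n z"]) auto
    qed
  next
    fix c u assume "c = 1 \<or> c = - 1" "u \<in> coord_space n" "burau_form z 1 u = - 2" "burau_form z 2 u = z"
      "\<And>j. 3 \<le> j \<Longrightarrow> j < n \<Longrightarrow> burau_form z j u = 0"
      "\<And>x. x \<in> coord_space n \<Longrightarrow> act n (transpose_mat (R (wb_elem n (Alpha 1)))) x
             = (\<lambda>i. c * (x i + burau_form z 1 x * u i))"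
    then show ?thesis by (rule tilde)
  qed
  then obtain k \<beta> where k: "k \<in> {-1, 1}" and \<beta>: "\<beta> \<in> ?B"
    and eq: "rep_equiv ?G (n - 1) \<rho> (char_tensor ?G (X_rep n 1 k) \<beta>)" by blast
  have B: "\<beta>' = burau_tilde n z \<or> \<beta>' = burau_hat n z \<and> z \<noteq> 1" if "\<beta>' \<in> ?B" for \<beta>'
    using that by (cases "z = 1") auto
  have hom: "\<beta>' \<in> hom ?G ?K" if "\<beta>' \<in> ?B" for \<beta>'
    using B[OF that] burau_tilde_rep(1)[OF n z] burau_hat_rep(1)[OF n z] by metis
  have unique: "k' = k \<and> \<beta>' = \<beta>"
    if k': "k' \<in> {-1, 1}" and \<beta>': "\<beta>' \<in> ?B"
      and eq': "rep_equiv ?G (n - 1) \<rho> (char_tensor ?G (X_rep n 1 k') \<beta>')" for k' \<beta>'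
  proof -
    define s where "s = (if \<beta> = burau_tilde n z then 1 else z)"
    define s' where "s' = (if \<beta>' = burau_tilde n z then 1 else z)"
    have s: "\<beta> = burau_tilde n z \<and> s = 1 \<or> \<beta> = burau_hat n z \<and> s = z \<and> z \<noteq> 1"
      unfolding s_def using B[OF \<beta>] by presburger
    have s': "\<beta>' = burau_tilde n z \<and> s' = 1 \<or> \<beta>' = burau_hat n z \<and> s' = z \<and> z \<noteq> 1"
      unfolding s'_def using B[OF \<beta>'] by presburger
    have kk: "k = 1 \<or> k = - 1" "k' = 1 \<or> k' = - 1" using k k' by auto
    have ss: "\<beta> = burau_tilde n z \<and> s = 1 \<or> \<beta> = burau_hat n z \<and> s = z"
      "\<beta>' = burau_tilde n z \<and> s' = 1 \<or> \<beta>' = burau_hat n z \<and> s' = z" using s s' by auto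
    note inv = twist_invariants[OF n z kk(1) \<rho> ss(1) eq] and inv' = twist_invariants[OF n z kk(2) \<rho> ss(2) eq']
    have "k * of_nat (n - 3) = k' * of_nat (n - 3)" by (rule HOL.trans[OF inv(1)[symmetric] inv'(1)])
    moreover have "(of_nat (n - 3) :: complex) \<noteq> 0" unfolding of_nat_eq_0_iff using n by simp
    ultimately have "k = k'" by simp
    moreover from this have "s = s'" using inv(2) inv'(2) kk(1) by auto
    ultimately show ?thesis using s s' by metis
  qed
  show ?thesis
  proof (rule ex1I[of _ "(k, \<beta>)"], unfold prod.case)
    show "k \<in> {-1, 1} \<and> \<beta> \<in> hom ?G ?K \<and> \<beta> \<in> ?B \<and> rep_equiv ?G (n - 1) \<rho> (char_tensor ?G (X_rep n 1 k) \<beta>)"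
      using k hom[OF \<beta>] \<beta> eq by blast
    fix p :: "complex \<times> (wb_gen word set \<Rightarrow> complex mat)"
    obtain k' \<beta>' where p: "p = (k', \<beta>')" by (cases p)
    assume "case p of (k, \<beta>') \<Rightarrow> k \<in> {-1, 1} \<and> \<beta>' \<in> hom ?G ?K \<and> \<beta>' \<in> ?B \<and>
      rep_equiv ?G (n - 1) \<rho> (char_tensor ?G (X_rep n 1 k) \<beta>')"
    then have "k' \<in> {-1, 1}" "\<beta>' \<in> ?B" "rep_equiv ?G (n - 1) \<rho> (char_tensor ?G (X_rep n 1 k') \<beta>')"
      unfolding p prod.case by (iprover)+
    then show "p = (k, \<beta>)" using unique[of k' \<beta>'] p by blast
  qed
qed

end
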